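(* Let $a\ge1$ and let $G$ be a subgraph of the complete multigraph $K_{n+1}^{a,1}$ on the vertex set $\{0,1,\ldots,n\}$ (i.e. a multigraph on this vertex set with at most $a$ edges between $0$ and each $i\in[n]$ and at most one edge between distinct $i,j\in[n]$). Then $\dim_{\mathbb{K}}(R_n/\mathcal{M}_G^{(1)})=\det\widetilde Q_G$ if and only if each essentially connected component $G_i$ of $G$, with vertex set $\{0\}\cup V_i$, is obtained from a complete multigraph $K^{a_i,1}$ on $\{0\}\cup V_i$ (having $a_i\ge1$ edges between $0$ and each vertex of $V_i$ and exactly one edge between any two distinct vertices of $V_i$) by deleting some edges through the root $0$.
   Context: All multigraphs are undirected and loopless. For a multigraph $G$ on $\{0,1,\ldots,n\}$ (root $0$), let $a_{i,j}$ be the number of edges between $i\neq j$ and $d_i=\sum_{j\ne i}a_{i,j}$. $\mathbb{K}$ is a field and $R_n=\mathbb{K}[x_1,\ldots,x_n]$. The $1$-skeleton ideal is $\mathcal{M}_G^{(1)}=\left\langle x_i^{d_i},\ x_i^{d_i-a_{i,j}}x_j^{d_j-a_{i,j}}\mid i\in[n],\ 1\le i<j\le n\right\rangle\subseteq R_n$. The truncated signless Laplace matrix $\widetilde Q_G$ is the $n\times n$ matrix with diagonal entries $d_1,\ldots,d_n$ and $(i,j)$-entry $a_{i,j}$ for $i\ne j$. Essentially connected components: let $\widetilde G$ be the induced subgraph of $G$ on $[n]$; for each connected component of $\widetilde G$ with vertex set $V_i$, the induced subgraph of $G$ on $V_i\cup\{0\}$ is an essentially connected component of $G$.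
   Formalization: The "only if" direction is stated only when the 1-skeleton ideal is a proper ideal of R_n (always so for connected G); otherwise it can fail, e.g. n=4, edges 01, 12, 23 and vertex 4 isolated, where dim = det = 0. The "if" direction is unrestricted. *)

theory Defs
  imports
    "HOL-Library.Poly_Mapping"
    "HOL-Algebra.QuotRing"
    "HOL-Algebra.Embedded_Algebras"
    "Jordan_Normal_Form.Determinant"
begin

section \<open>Multigraphs with root 0\<close>

text \<open>A multigraph is given by its vertex set and the number of edges between any two vertices;
  edges carry no identity of their own.\<close>

record multigraph =
  verts :: "nat set"
  emult :: "nat \<Rightarrow> nat \<Rightarrow> nat"

definition wf_multigraph :: "multigraph \<Rightarrow> bool" where
  "wf_multigraph G \<longleftrightarrow> finite (verts G)
     \<and> (\<forall>u v. emult G u v = emult G v u)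
     \<and> (\<forall>u. emult G u u = 0)
     \<and> (\<forall>u v. emult G u v \<noteq> 0 \<longrightarrow> u \<in> verts G \<and> v \<in> verts G)"

definition vdegree :: "multigraph \<Rightarrow> nat \<Rightarrow> nat" where
  "vdegree G i = (\<Sum>j \<in> verts G - {i}. emult G i j)"

definition subgraph :: "multigraph \<Rightarrow> multigraph \<Rightarrow> bool" where
  "subgraph H G \<longleftrightarrow> verts H \<subseteq> verts G \<and> (\<forall>u v. emult H u v \<le> emult G u v)"

definition induced :: "multigraph \<Rightarrow> nat set \<Rightarrow> multigraph" where
  "induced G W =
     \<lparr>verts = W, emult = (\<lambda>u v. if u \<in> W \<and> v \<in> W then emult G u v else 0)\<rparr>"

definition adjacency :: "multigraph \<Rightarrow> (nat \<times> nat) set" where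
  "adjacency G = {(u, v). u \<in> verts G \<and> v \<in> verts G \<and> emult G u v \<noteq> 0}"

definition component_verts :: "multigraph \<Rightarrow> nat set set" where
  "component_verts G = {(adjacency G)\<^sup>* `` {v} | v. v \<in> verts G}"

definition ess_connected_components :: "multigraph \<Rightarrow> multigraph set" where
  "ess_connected_components G =
     {induced G (insert 0 V) | V. V \<in> component_verts (induced G (verts G - {0}))}"

text \<open>On the vertex set \<open>W\<close>: \<open>a\<close> edges between the root and every other vertex, \<open>b\<close> edges between
  any two distinct vertices other than the root.\<close>

definition complete_multigraph :: "nat set \<Rightarrow> nat \<Rightarrow> nat \<Rightarrow> multigraph" where
  "complete_multigraph W a b =
     \<lparr>verts = W,
      emult = (\<lambda>u v. if u \<in> W \<and> v \<in> W \<and> u \<noteq> v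
                     then (if u = 0 \<or> v = 0 then a else b) else 0)\<rparr>"

text \<open>\<open>H\<close> arises from \<open>K\<close> by deleting some (possibly none, possibly all) edges incident to the
  root.\<close>

definition root_edge_deletion :: "multigraph \<Rightarrow> multigraph \<Rightarrow> bool" where
  "root_edge_deletion H K \<longleftrightarrow> verts H = verts K
     \<and> (\<forall>u v. emult H u v \<le> emult K u v)
     \<and> (\<forall>u v. u \<noteq> 0 \<and> v \<noteq> 0 \<longrightarrow> emult H u v = emult K u v)"

text \<open>Matrix indices start at 0, so row \<open>i\<close> belongs to the vertex \<open>i + 1\<close>.\<close>

definition trunc_signless_laplace :: "nat \<Rightarrow> multigraph \<Rightarrow> int mat" where
  "trunc_signless_laplace n G =
     mat n n (\<lambda>(i, j). if i = j then int (vdegree G (Suc i))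
                       else int (emult G (Suc i) (Suc j)))"

section \<open>The polynomial ring and the 1-skeleton ideal\<close>

text \<open>A monomial is a finitely supported exponent function \<open>nat \<Rightarrow>\<^sub>0 nat\<close>, and a polynomial a
  finitely supported function from monomials to coefficients. The ring in \<open>x\<^sub>1, \<dots>, x\<^sub>n\<close> is the
  subring of those polynomials in which no other variable occurs.\<close>

type_synonym 'k mpoly = "(nat \<Rightarrow>\<^sub>0 nat) \<Rightarrow>\<^sub>0 'k"

definition const :: "'k::field \<Rightarrow> 'k mpoly" where
  "const c = Poly_Mapping.single 0 c"

definition var :: "nat \<Rightarrow> 'k::field mpoly" where
  "var i = Poly_Mapping.single (Poly_Mapping.single i 1) 1"

definition poly_ring :: "nat \<Rightarrow> 'k::field mpoly ring" where
  "poly_ring n =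
     \<lparr>carrier = {p. \<forall>m \<in> Poly_Mapping.keys p. Poly_Mapping.keys m \<subseteq> {1..n}},
      monoid.mult = (*), one = 1, zero = 0, add = (+)\<rparr>"

definition one_skeleton_ideal :: "nat \<Rightarrow> multigraph \<Rightarrow> 'k::field mpoly set" where
  "one_skeleton_ideal n G = genideal (poly_ring n)
     ({var i ^ vdegree G i | i. i \<in> {1..n}} \<union>
      {var i ^ (vdegree G i - emult G i j) * var j ^ (vdegree G j - emult G i j) | i j.
         1 \<le> i \<and> i < j \<and> j \<le> n})"

text \<open>\<open>R/I\<close> has dimension \<open>m\<close> over the field of constants. The library expresses this relative to the
  image of the constants in \<open>R/I\<close>, which is a subfield unless \<open>R/I\<close> is the zero ring; in that case
  the predicate holds exactly for \<open>m = 0\<close>.\<close>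

definition has_quotient_dim ::
  "'k::field mpoly ring \<Rightarrow> 'k mpoly set \<Rightarrow> nat \<Rightarrow> bool" where
  "has_quotient_dim R I m \<longleftrightarrow>
     ring.dimension (R Quot I) m (range (\<lambda>c. I +>\<^bsub>R\<^esub> const c)) (carrier (R Quot I))"

end

(*
  Write d_i for the degrees and let A be the adjacency matrix of G restricted to 1..n. A monomial x^b
  lies outside the ideal iff b_i < d_i for all i and the vertices with b_i = d_i - 1 are pairwise
  nonadjacent. Hence the quotient has dimension F(V) = sum over independent S of prod_{i not in S} (d_i - 1).

  For a vertex v with neighbourhood N and closed neighbourhood N[v] there are the recurrences
    F(W) = (d_v - 1) F(W - v) + prod_{u in N} (d_u - 1) F(W - N[v]),
    det Q(W) = (d_v - 1) det Q(W - v) + det P,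
  where P is Q(W - v) minus the all-ones matrix on N. The matrix P has diagonal entries d_u - 1 on N and
  agrees with Q outside N. Since Q is positive semidefinite, P is positive semidefinite or has
  nonpositive determinant, and Fischer's inequality gives det P <= prod_{u in N} (d_u - 1) det Q(W - N[v]),
  so that det Q <= F by induction. If the components are cliques, the rows of P in N are diagonal and
  equality holds throughout. Otherwise an induced path u - v - w gives P the entry -1 at (u, w), and
  Fischer's inequality is strict as soon as the right-hand side is positive.
*)

theory Submission
  imports Defs
begin

section \<open>Principal minors and positive semidefinite kernels\<close>

text \<open>For the unit ideal the converse fails: with an isolated vertex besides a path on three
  non-root vertices, dimension and determinant are both 0, yet the path is not a clique. Properness
  excludes vertices of degree 0 and adjacent vertices of degree 1, either of which would make 1 a
  generator, and this is what makes \<open>ipoly\<close> positive. The obstacle to det Q <= F is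
  that P need not be positive semidefinite: it is the Schur complement of Q(W) after lowering d_v to
  1, and lowering a diagonal entry can destroy semidefiniteness. But Q(W - v) is untouched, so by
  interlacing at most one eigenvalue becomes negative, and a positive determinant excludes that one
  as well. A nonpositive determinant satisfies the bound anyway. Strictness needs every neighbour of
  the pivot to have degree above 1. A neighbour x of v with degree 1 has no other neighbour than v,
  and taking x as the pivot gives an off-diagonal entry 1 in place of -1. Determinants are indexed
  by vertex sets, so that deleting vertices needs no renumbering.\<close>

definition pdet :: "('v \<Rightarrow> 'v \<Rightarrow> real) \<Rightarrow> 'v set \<Rightarrow> real" where
  "pdet A S = (\<Sum>p | p permutes S. of_int (sign p) * (\<Prod>i\<in>S. A i (p i)))"

lemma pdet_cong:
  assumes "\<And>i j. i \<in> S \<Longrightarrow> j \<in> S \<Longrightarrow> A i j = B i j"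
  shows "pdet A S = pdet B S"
  unfolding pdet_def
  by (intro sum.cong refl arg_cong2[where f="(*)"] prod.cong)
     (auto simp: assms permutes_in_image)

lemma pdet_empty [simp]: "pdet A {} = 1"
  by (simp add: pdet_def)

text \<open>A permutation that moves \<open>v\<close> meets a zero entry, and those that fix
  \<open>v\<close> are the permutations of \<open>S - {v}\<close>, with the same sign. A hypothesis
  about permutations covers a cleared row and a cleared column at once.\<close>

lemma pdet_split:
  assumes "finite S" "v \<in> S" "\<And>p. p permutes S \<Longrightarrow> p v \<noteq> v \<Longrightarrow> \<exists>i\<in>S. A i (p i) = 0"
  shows "pdet A S = A v v * pdet A (S - {v})"
proof -
  have sub: "p permutes S" if "p permutes S - {v}" for p
    using that permutes_subset by blast
  have fix_v: "p v = v" if "p permutes S - {v}" for p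
    using that by (simp add: permutes_not_in)
  have perm: "p permutes S - {v}" if "p permutes S" "p v = v" for p
    using that by (auto intro!: permutes_superset[OF that(1)])
  have "pdet A S = (\<Sum>p | p permutes S - {v}. of_int (sign p) * (\<Prod>i\<in>S. A i (p i)))"
    unfolding pdet_def
  proof (rule sum.mono_neutral_right)
    show "finite {p. p permutes S}" using assms(1) by (rule finite_permutations)
    show "{p. p permutes S - {v}} \<subseteq> {p. p permutes S}" using sub by auto
    show "\<forall>p\<in>{p. p permutes S} - {p. p permutes S - {v}}.
            of_int (sign p) * (\<Prod>i\<in>S. A i (p i)) = 0"
      using assms(1,3) perm by (auto simp: prod_zero_iff)
  qed
  also have "\<dots> = (\<Sum>p | p permutes S - {v}. A v v * (of_int (sign p) * (\<Prod>i\<in>S - {v}. A i (p i))))"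
    by (rule sum.cong) (use assms(1,2) in \<open>simp_all add: prod.remove[of S v] fix_v\<close>)
  finally show ?thesis by (simp add: pdet_def sum_distrib_left)
qed

lemma pdet_unit_row:
  assumes "finite S" "v \<in> S" "\<And>j. j \<in> S \<Longrightarrow> j \<noteq> v \<Longrightarrow> A v j = 0"
  shows "pdet A S = A v v * pdet A (S - {v})"
  using assms by (intro pdet_split) (auto intro!: bexI[of _ v] simp: permutes_in_image)

lemma pdet_unit_column:
  assumes "finite S" "v \<in> S" "\<And>i. i \<in> S \<Longrightarrow> i \<noteq> v \<Longrightarrow> A i v = 0"
  shows "pdet A S = A v v * pdet A (S - {v})"
proof (rule pdet_split[OF assms(1,2)])
  fix p assume p: "p permutes S" "p v \<noteq> v"
  then obtain i where "i \<in> S" "p i = v" using assms(2) by (metis permutes_image imageE)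
  with p assms(3) show "\<exists>i\<in>S. A i (p i) = 0" by metis
qed

lemma pdet_row_add:
  assumes "finite S" "v \<in> S"
  shows "pdet (A(v := \<lambda>j. f j + c * g j)) S = pdet (A(v := f)) S + c * pdet (A(v := g)) S"
proof -
  have upd: "(\<Prod>i\<in>S. (A(v := h)) i (p i)) = h (p v) * (\<Prod>i\<in>S - {v}. A i (p i))" for h p
    using assms by (simp add: prod.remove[of S v])
  show ?thesis
    unfolding pdet_def upd by (simp add: sum_distrib_left sum.distrib[symmetric] algebra_simps)
qed

text \<open>Composing with the transposition of \<open>u\<close> and \<open>v\<close> flips every
  sign but keeps every product, so the sum equals its own negative.\<close>

lemma pdet_equal_rows:
  assumes "finite S" "u \<in> S" "v \<in> S" "u \<noteq> v" "A u = A v"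
  shows "pdet A S = 0"
proof -
  let ?t = "Transposition.transpose u v"
  have t: "?t permutes S" using assms by (simp add: permutes_swap_id)
  have At: "A (?t i) = A i" for i using assms(5) by (auto simp: Transposition.transpose_def)
  have "pdet A S = (\<Sum>p | p permutes S. of_int (sign (p \<circ> ?t)) * (\<Prod>i\<in>S. A i ((p \<circ> ?t) i)))"
    unfolding pdet_def by (rule sum_permutations_compose_right[OF t])
  also have "\<dots> = (\<Sum>p | p permutes S. - (of_int (sign p) * (\<Prod>i\<in>S. A i (p i))))"
  proof (rule sum.cong[OF refl])
    fix p assume p: "p \<in> {p. p permutes S}"
    have "(\<Prod>i\<in>S. A i ((p \<circ> ?t) i)) = (\<Prod>i\<in>S. (\<lambda>i. A i (p i)) (?t i))"
      by (simp add: At)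
    also have "\<dots> = (\<Prod>i\<in>S. A i (p i))"
      using prod.permute[OF t, of "\<lambda>i. A i (p i)"] by (simp add: comp_def)
    moreover have "sign (p \<circ> ?t) = - sign p"
      using p assms by (subst sign_compose)
        (auto simp: sign_swap_id permutation_swap_id intro: permutation_permutes[THEN iffD2])
    ultimately show "of_int (sign (p \<circ> ?t)) * (\<Prod>i\<in>S. A i ((p \<circ> ?t) i))
        = - (of_int (sign p) * (\<Prod>i\<in>S. A i (p i)))" by simp
  qed
  also have "\<dots> = - pdet A S" by (simp add: pdet_def sum_negf)
  finally show ?thesis by simp
qed

text \<open>As \<open>v\<close> lies outside \<open>T\<close>, the pivot row survives every update,
  and each update adds a multiple of a determinant with two equal rows.\<close>

lemma pdet_row_operations:
  assumes "finite S" "v \<in> S" "T \<subseteq> S - {v}"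
  shows "pdet (\<lambda>i j. if i \<in> T then A i j + c i * A v j else A i j) S = pdet A S"
proof -
  have "finite T" using assms finite_subset by fast
  then show ?thesis using assms(3)
  proof (induction T)
    case empty
    then show ?case by simp
  next
    case (insert u T)
    define B where "B = (\<lambda>i j. if i \<in> T then A i j + c i * A v j else A i j)"
    have u: "u \<in> S" "u \<noteq> v" "u \<notin> T" "v \<notin> T"
      using insert.prems insert.hyps by auto
    have "(\<lambda>i j. if i \<in> insert u T then A i j + c i * A v j else A i j)
        = B(u := \<lambda>j. B u j + c u * B v j)"
      by (intro ext) (use u in \<open>simp add: B_def\<close>)
    then have "pdet (\<lambda>i j. if i \<in> insert u T then A i j + c i * A v j else A i j) S
        = pdet (B(u := B u)) S + c u * pdet (B(u := B v)) S"
      using pdet_row_add[OF assms(1) u(1), of B "B u" "c u" "B v"] by simp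
    also have "pdet (B(u := B v)) S = 0"
      using u assms(1,2) by (intro pdet_equal_rows[of S u v]) auto
    also have "B(u := B u) = B" by (rule fun_upd_triv)
    also have "pdet B S = pdet A S"
      unfolding B_def by (rule insert.IH) (use insert.prems in auto)
    finally show ?case by simp
  qed
qed

section \<open>Schur complements and positive semidefinite kernels\<close>

definition schur :: "('v \<Rightarrow> 'v \<Rightarrow> real) \<Rightarrow> 'v \<Rightarrow> 'v \<Rightarrow> 'v \<Rightarrow> real" where
  "schur A v i j = A i j - A i v * A v j / A v v"

lemma pdet_schur:
  assumes "finite S" "v \<in> S" "A v v \<noteq> 0"
  shows "pdet A S = A v v * pdet (schur A v) (S - {v})"
proof -
  let ?B = "\<lambda>i j. if i \<in> S - {v} then A i j + - (A i v / A v v) * A v j else A i j"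
  have "pdet A S = pdet ?B S"
    using pdet_row_operations[OF assms(1,2) order_refl, of A "\<lambda>i. - (A i v / A v v)"] by simp
  also have "\<dots> = ?B v v * pdet ?B (S - {v})"
    using assms by (intro pdet_unit_column) auto
  also have "pdet ?B (S - {v}) = pdet (schur A v) (S - {v})"
    by (rule pdet_cong) (auto simp: schur_def)
  finally show ?thesis by simp
qed

text \<open>By linearity in row \<open>v\<close>, the perturbation contributes \<open>t\<close>
  times a determinant with a unit row. This drives both the recurrence \<open>pdet_rec\<close> and
  the zero-pivot case of \<open>psd_on_if_pdet_pos\<close>.\<close>

lemma pdet_diag_add:
  assumes "finite S" "v \<in> S"
  shows "pdet (\<lambda>i j. A i j + (if i = v \<and> j = v then t else 0)) S = pdet A S + t * pdet A (S - {v})"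
proof -
  let ?e = "\<lambda>j. if j = v then 1 else 0"
  have "pdet (\<lambda>i j. A i j + (if i = v \<and> j = v then t else 0)) S
      = pdet (A(v := \<lambda>j. A v j + t * ?e j)) S"
    by (rule pdet_cong) auto
  also have "\<dots> = pdet A S + t * pdet (A(v := ?e)) S"
    by (subst pdet_row_add[OF assms]) simp
  also have "pdet (A(v := ?e)) S = pdet (A(v := ?e)) (S - {v})"
    using pdet_unit_row[OF assms, of "A(v := ?e)"] by simp
  also have "\<dots> = pdet A (S - {v})"
    by (rule pdet_cong) auto
  finally show ?thesis .
qed

text \<open>Symmetry is imposed on all indices, so that it carries over to subsets and Schur
  complements without side conditions.\<close>

definition symmetric_kernel :: "('v \<Rightarrow> 'v \<Rightarrow> real) \<Rightarrow> bool" where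
  "symmetric_kernel A \<longleftrightarrow> (\<forall>i j. A i j = A j i)"

lemma symmetric_kernelD: "symmetric_kernel A \<Longrightarrow> A i j = A j i"
  by (simp add: symmetric_kernel_def)

definition psd_on :: "'v set \<Rightarrow> ('v \<Rightarrow> 'v \<Rightarrow> real) \<Rightarrow> bool" where
  "psd_on S A \<longleftrightarrow> (\<forall>x. 0 \<le> (\<Sum>i\<in>S. \<Sum>j\<in>S. A i j * x i * x j))"

lemma psd_on_subset:
  assumes "psd_on S A" "T \<subseteq> S" "finite S"
  shows "psd_on T A"
  unfolding psd_on_def
proof
  fix x :: "'a \<Rightarrow> real"
  let ?y = "\<lambda>i. if i \<in> T then x i else 0"
  have "(\<Sum>i\<in>S. \<Sum>j\<in>S. A i j * ?y i * ?y j) = (\<Sum>i\<in>T. \<Sum>j\<in>S. A i j * ?y i * ?y j)"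
    using assms by (intro sum.mono_neutral_right) auto
  also have "\<dots> = (\<Sum>i\<in>T. \<Sum>j\<in>T. A i j * ?y i * ?y j)"
    using assms by (intro sum.cong refl sum.mono_neutral_right) auto
  also have "\<dots> = (\<Sum>i\<in>T. \<Sum>j\<in>T. A i j * x i * x j)"
    by (intro sum.cong) auto
  finally have eq: "(\<Sum>i\<in>S. \<Sum>j\<in>S. A i j * ?y i * ?y j) = (\<Sum>i\<in>T. \<Sum>j\<in>T. A i j * x i * x j)" .
  show "0 \<le> (\<Sum>i\<in>T. \<Sum>j\<in>T. A i j * x i * x j)"
    unfolding eq[symmetric] using assms(1) unfolding psd_on_def by (rule spec)
qed

lemma psd_on_diag:
  assumes "psd_on S A" "finite S" "v \<in> S"
  shows "0 \<le> A v v"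
proof -
  have "psd_on {v} A" using psd_on_subset[OF assms(1)] assms by auto
  then have "0 \<le> (\<Sum>i\<in>{v}. \<Sum>j\<in>{v}. A i j * 1 * 1)"
    unfolding psd_on_def by (rule spec)
  then show ?thesis by simp
qed

text \<open>With value \<open>t\<close> at \<open>v\<close> and 1 at \<open>w\<close>, the form is
  affine in \<open>t\<close> because \<open>A v v = 0\<close>; an affine function that is never
  negative has slope 0.\<close>

lemma psd_on_zero_diag:
  assumes "psd_on S A" "finite S" "v \<in> S" "w \<in> S" "A v w = A w v" "A v v = 0"
  shows "A v w = 0"
proof (cases "v = w")
  case False
  have "psd_on {v, w} A" using psd_on_subset[OF assms(1)] assms by auto
  have pos: "0 \<le> 2 * t * A v w + A w w" for t
  proof -
    let ?x = "\<lambda>i. if i = v then t else 1"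
    have "0 \<le> (\<Sum>i\<in>{v, w}. \<Sum>j\<in>{v, w}. A i j * ?x i * ?x j)"
      using \<open>psd_on {v, w} A\<close> unfolding psd_on_def by (rule spec)
    also have "\<dots> = 2 * t * A v w + A w w"
      using False assms(5)[symmetric] assms(6) by simp
    finally show ?thesis .
  qed
  show ?thesis
  proof (rule ccontr)
    assume "A v w \<noteq> 0"
    \<comment> \<open>This choice of \<open>t\<close> gives the form the value -1.\<close>
    then have "2 * (- (A w w + 1) / (2 * A v w)) * A v w = - (A w w + 1)" by simp
    with pos[of "- (A w w + 1) / (2 * A v w)"] show False by linarith
  qed
qed (use assms in auto)

text \<open>Completing the square in the variable \<open>x v\<close>.\<close>

lemma quadratic_form_schur:
  assumes "finite S" "v \<in> S" "A v v \<noteq> 0" "symmetric_kernel A"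
  shows "(\<Sum>i\<in>S. \<Sum>j\<in>S. A i j * x i * x j)
    = A v v * (x v + (\<Sum>j\<in>S - {v}. A v j * x j) / A v v)\<^sup>2
      + (\<Sum>i\<in>S - {v}. \<Sum>j\<in>S - {v}. schur A v i j * x i * x j)"
proof -
  let ?T = "S - {v}"
  define L where "L = (\<Sum>j\<in>?T. A v j * x j)"
  define q where "q = (\<Sum>i\<in>?T. \<Sum>j\<in>?T. A i j * x i * x j)"
  have sym: "A i v = A v i" if "i \<in> ?T" for i using assms(4) by (rule symmetric_kernelD)
  have row: "(\<Sum>j\<in>S. A i j * x i * x j) = A i v * x i * x v + (\<Sum>j\<in>?T. A i j * x i * x j)" for i
    by (rule sum.remove[OF assms(1,2)])
  have Lv: "(\<Sum>j\<in>?T. A v j * x v * x j) = x v * L"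
    unfolding L_def sum_distrib_left by (intro sum.cong) auto
  have Lv': "(\<Sum>i\<in>?T. A i v * x i * x v) = x v * L"
    unfolding L_def sum_distrib_left by (intro sum.cong) (simp_all add: sym)
  have "(\<Sum>i\<in>S. \<Sum>j\<in>S. A i j * x i * x j)
      = (A v v * x v * x v + x v * L) + (\<Sum>i\<in>?T. A i v * x i * x v + (\<Sum>j\<in>?T. A i j * x i * x j))"
    unfolding row by (subst sum.remove[OF assms(1,2)]) (simp only: Lv)
  also have "\<dots> = A v v * (x v)\<^sup>2 + 2 * x v * L + q"
    by (simp add: sum.distrib Lv' q_def power2_eq_square)
  finally have full: "(\<Sum>i\<in>S. \<Sum>j\<in>S. A i j * x i * x j) = A v v * (x v)\<^sup>2 + 2 * x v * L + q" .
  have "L\<^sup>2 / A v v = (\<Sum>i\<in>?T. \<Sum>j\<in>?T. (A v i * x i) * (A v j * x j) / A v v)"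
    unfolding L_def power2_eq_square sum_product sum_divide_distrib ..
  also have "\<dots> = (\<Sum>i\<in>?T. \<Sum>j\<in>?T. A i v * A v j / A v v * x i * x j)"
    by (intro sum.cong refl) (simp add: sym)
  finally have LL: "L\<^sup>2 / A v v = (\<Sum>i\<in>?T. \<Sum>j\<in>?T. A i v * A v j / A v v * x i * x j)" .
  have rest: "(\<Sum>i\<in>?T. \<Sum>j\<in>?T. schur A v i j * x i * x j) = q - L\<^sup>2 / A v v"
    unfolding LL q_def schur_def by (simp add: sum_subtractf left_diff_distrib)
  show ?thesis
    unfolding full rest L_def[symmetric] using assms(3) by (simp add: field_simps power2_eq_square)
qed

lemma psd_on_schur_iff:
  assumes "finite S" "v \<in> S" "A v v > 0" "symmetric_kernel A"
  shows "psd_on (S - {v}) (schur A v) \<longleftrightarrow> psd_on S A"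
proof
  assume psd: "psd_on (S - {v}) (schur A v)"
  show "psd_on S A"
    unfolding psd_on_def
  proof
    fix x :: "'a \<Rightarrow> real"
    have "0 \<le> (\<Sum>i\<in>S - {v}. \<Sum>j\<in>S - {v}. schur A v i j * x i * x j)"
      using psd unfolding psd_on_def by (rule spec)
    then show "0 \<le> (\<Sum>i\<in>S. \<Sum>j\<in>S. A i j * x i * x j)"
      unfolding quadratic_form_schur[OF assms(1,2) less_imp_neq[OF assms(3), symmetric] assms(4)]
      using assms(3) by (intro add_nonneg_nonneg mult_nonneg_nonneg) simp_all
  qed
next
  assume psd: "psd_on S A"
  show "psd_on (S - {v}) (schur A v)"
    unfolding psd_on_def
  proof
    fix x :: "'a \<Rightarrow> real"
    \<comment> \<open>The value at \<open>v\<close> is the one that makes the square in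
      \<open>quadratic_form_schur\<close> vanish.\<close>
    let ?y = "x(v := - (\<Sum>j\<in>S - {v}. A v j * x j) / A v v)"
    have "(\<Sum>j\<in>S - {v}. A v j * ?y j) = (\<Sum>j\<in>S - {v}. A v j * x j)"
      by (rule sum.cong) auto
    then have "?y v + (\<Sum>j\<in>S - {v}. A v j * ?y j) / A v v = 0"
      by simp
    then have "(\<Sum>i\<in>S. \<Sum>j\<in>S. A i j * ?y i * ?y j)
        = (\<Sum>i\<in>S - {v}. \<Sum>j\<in>S - {v}. schur A v i j * ?y i * ?y j)"
      unfolding quadratic_form_schur[OF assms(1,2) less_imp_neq[OF assms(3), symmetric] assms(4), of ?y]
      by (simp only: power2_eq_square mult_zero_left mult_zero_right add_0)
    also have "\<dots> = (\<Sum>i\<in>S - {v}. \<Sum>j\<in>S - {v}. schur A v i j * x i * x j)"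
      by (intro sum.cong) auto
    finally have eq: "(\<Sum>i\<in>S. \<Sum>j\<in>S. A i j * ?y i * ?y j)
        = (\<Sum>i\<in>S - {v}. \<Sum>j\<in>S - {v}. schur A v i j * x i * x j)" .
    show "0 \<le> (\<Sum>i\<in>S - {v}. \<Sum>j\<in>S - {v}. schur A v i j * x i * x j)"
      unfolding eq[symmetric] using psd unfolding psd_on_def by (rule spec)
  qed
qed

lemma symmetric_schur:
  assumes "symmetric_kernel A"
  shows "symmetric_kernel (schur A v)"
  unfolding symmetric_kernel_def
proof (intro allI)
  fix i j
  show "schur A v i j = schur A v j i"
    using symmetric_kernelD[OF assms, of i j] symmetric_kernelD[OF assms, of i v]
      symmetric_kernelD[OF assms, of j v]
    by (simp add: schur_def)
qed

text \<open>The drop of the diagonal, a square over the pivot, is the source of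
  \<open>pdet_psd_remove\<close> and, when \<open>A v w\<close> is nonzero, of its strict
  form.\<close>

lemma schur_diag:
  assumes "A v v > 0" "symmetric_kernel A"
  shows "schur A v w w = A w w - (A v w)\<^sup>2 / A v v"
  using assms(1) symmetric_kernelD[OF assms(2), of w v] by (simp add: schur_def power2_eq_square)

section \<open>Fischer-type determinant inequalities\<close>

lemma pdet_psd_zero_diag:
  assumes "finite S" "psd_on S A" "symmetric_kernel A" "v \<in> S" "A v v = 0"
  shows "pdet A S = 0"
  using pdet_unit_row[OF assms(1,4), of A]
    psd_on_zero_diag[OF assms(2,1,4) _ symmetric_kernelD[OF assms(3)] assms(5)] assms(5)
  by simp

lemma pdet_psd_nonneg:
  assumes "finite S" "psd_on S A" "symmetric_kernel A"
  shows "0 \<le> pdet A S"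
  using assms
proof (induction "card S" arbitrary: S A)
  case (Suc n)
  then obtain v where v: "v \<in> S" by fastforce
  show ?case
  proof (cases "A v v = 0")
    case True
    then show ?thesis using pdet_psd_zero_diag[OF Suc.prems v] by simp
  next
    case False
    then have pos: "A v v > 0" using psd_on_diag[OF Suc.prems(2,1) v] by simp
    have "0 \<le> pdet (schur A v) (S - {v})"
    proof (rule Suc.hyps(1))
      show "psd_on (S - {v}) (schur A v)"
        using psd_on_schur_iff[OF Suc.prems(1) v pos Suc.prems(3)] Suc.prems(2) by simp
      show "symmetric_kernel (schur A v)"
        using Suc.prems(3) by (rule symmetric_schur)
    qed (use Suc.hyps(2) Suc.prems(1) v in auto)
    then show ?thesis using pdet_schur[OF Suc.prems(1) v] pos by simp
  qed
qed simp

text \<open>The induction pivots at some \<open>w\<close> other than \<open>v\<close>, so that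
  \<open>v\<close> survives in the Schur complement and the induction hypothesis applies to it;
  replacing the smaller diagonal entry there by \<open>A v v\<close> only increases the
  bound.\<close>

lemma pdet_psd_remove:
  assumes "finite S" "psd_on S A" "symmetric_kernel A" "v \<in> S"
  shows "pdet A S \<le> A v v * pdet A (S - {v})"
  using assms
proof (induction "card S" arbitrary: S A)
  case (Suc n)
  show ?case
  proof (cases "S = {v}")
    case True
    then show ?thesis using pdet_unit_row[of S v A] by simp
  next
    case False
    then obtain w where w: "w \<in> S" "w \<noteq> v" using Suc.prems by blast
    have psdv: "psd_on (S - {v}) A" using psd_on_subset[OF Suc.prems(2)] Suc.prems by auto
    have nn: "0 \<le> pdet A (S - {v})" using pdet_psd_nonneg[OF _ psdv] Suc.prems by auto
    show ?thesis
    proof (cases "A w w = 0")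
      case True
      then show ?thesis
        using pdet_psd_zero_diag[OF Suc.prems(1-3) w(1)] nn psd_on_diag[OF Suc.prems(2,1,4)] by simp
    next
      case False
      then have pos: "A w w > 0" using psd_on_diag[OF Suc.prems(2,1) w(1)] by simp
      have eq: "S - {v} - {w} = S - {w} - {v}" by auto
      have IH: "pdet (schur A w) (S - {w}) \<le> schur A w v v * pdet (schur A w) (S - {w} - {v})"
      proof (rule Suc.hyps(1))
        show "psd_on (S - {w}) (schur A w)"
          using psd_on_schur_iff[OF Suc.prems(1) w(1) pos Suc.prems(3)] Suc.prems(2) by simp
        show "symmetric_kernel (schur A w)"
          using Suc.prems(3) by (rule symmetric_schur)
      qed (use Suc.hyps(2) Suc.prems(1,4) w in auto)
      have "pdet A S = A w w * pdet (schur A w) (S - {w})"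
        using pdet_schur[OF Suc.prems(1) w(1)] pos by simp
      also have "\<dots> \<le> A w w * (schur A w v v * pdet (schur A w) (S - {w} - {v}))"
        using IH pos by simp
      \<comment> \<open>\<open>pdet_schur\<close> is read backwards here, on
        \<open>S - {v}\<close>.\<close>
      also have "\<dots> = schur A w v v * pdet A (S - {v})"
        using pdet_schur[of "S - {v}" w A] Suc.prems w pos by (simp add: eq)
      also have "\<dots> \<le> A v v * pdet A (S - {v})"
        using nn pos
        by (intro mult_right_mono) (simp_all add: schur_diag[OF pos Suc.prems(3)])
      finally show ?thesis .
    qed
  qed
qed simp

text \<open>Pivoting at the given \<open>w\<close> makes the diagonal entry at \<open>v\<close> drop
  strictly, and the minor multiplied with it is positive.\<close>

lemma pdet_psd_remove_strict:
  assumes "finite S" "psd_on S A" "symmetric_kernel A" "v \<in> S" "0 < pdet A S"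
    and "w \<in> S" "w \<noteq> v" "A v w \<noteq> 0"
  shows "pdet A S < A v v * pdet A (S - {v})"
proof -
  have "A w w \<noteq> 0" using pdet_psd_zero_diag[OF assms(1-3,6)] assms(5) by auto
  then have pos: "A w w > 0" using psd_on_diag[OF assms(2,1,6)] by simp
  have psdv: "psd_on (S - {v}) A" using psd_on_subset[OF assms(2)] assms by auto
  have nn: "0 \<le> pdet A (S - {v})" using pdet_psd_nonneg[OF _ psdv] assms by auto
  \<comment> \<open>The minor cannot vanish, since a multiple of it bounds the positive
    \<open>pdet A S\<close>.\<close>
  moreover have "pdet A (S - {v}) \<noteq> 0" using pdet_psd_remove[OF assms(1-4)] assms(5) by auto
  ultimately have gt: "0 < pdet A (S - {v})" by simp
  have eq: "S - {v} - {w} = S - {w} - {v}" by auto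
  have le: "pdet (schur A w) (S - {w}) \<le> schur A w v v * pdet (schur A w) (S - {w} - {v})"
  proof (rule pdet_psd_remove)
    show "psd_on (S - {w}) (schur A w)"
      using psd_on_schur_iff[OF assms(1,6) pos assms(3)] assms(2) by simp
    show "symmetric_kernel (schur A w)"
      using assms(3) by (rule symmetric_schur)
  qed (use assms in auto)
  have "pdet A S = A w w * pdet (schur A w) (S - {w})"
    using pdet_schur[OF assms(1,6)] pos by simp
  also have "\<dots> \<le> A w w * (schur A w v v * pdet (schur A w) (S - {w} - {v}))"
    using le pos by simp
  also have "\<dots> = schur A w v v * pdet A (S - {v})"
    using pdet_schur[of "S - {v}" w A] assms pos by (simp add: eq)
  also have "\<dots> < A v v * pdet A (S - {v})"
    using gt pos assms(8) symmetric_kernelD[OF assms(3), of v w]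
    by (intro mult_strict_right_mono) (simp_all add: schur_diag[OF pos assms(3)])
  finally show ?thesis .
qed

text \<open>Fischer's inequality for the block \<open>N\<close>, with Hadamard's bound already
  applied inside the block: the vertices of \<open>N\<close> are split off one at a time.\<close>

lemma pdet_psd_fischer:
  assumes "finite S" "psd_on S A" "symmetric_kernel A" "N \<subseteq> S"
  shows "pdet A S \<le> (\<Prod>u\<in>N. A u u) * pdet A (S - N)"
proof -
  have "finite N" using assms(1,4) by (rule rev_finite_subset)
  then show ?thesis using assms(4)
  proof (induction N)
    case (insert u N)
    have "psd_on (S - N) A" using psd_on_subset[OF assms(2)] assms(1) by auto
    then have "pdet A (S - N) \<le> A u u * pdet A (S - N - {u})"
      using insert assms by (intro pdet_psd_remove) auto
    moreover have "0 \<le> (\<Prod>u\<in>N. A u u)"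
      using insert psd_on_diag[OF assms(2,1)] by (intro prod_nonneg) auto
    ultimately have "(\<Prod>u\<in>N. A u u) * pdet A (S - N)
        \<le> (\<Prod>u\<in>N. A u u) * (A u u * pdet A (S - N - {u}))"
      by (rule mult_left_mono)
    moreover have "S - insert u N = S - N - {u}" by auto
    ultimately show ?case using insert by (simp add: mult_ac)
  qed simp
qed

text \<open>Only the removal of \<open>u\<close> needs to be strict. It comes first, while
  \<open>w\<close> is still present, because \<open>w\<close> may itself belong to
  \<open>N\<close>.\<close>

lemma pdet_psd_fischer_strict:
  assumes "finite S" "psd_on S A" "symmetric_kernel A" "N \<subseteq> S" "0 < pdet A S"
    and "u \<in> N" "w \<in> S" "w \<noteq> u" "A u w \<noteq> 0"
  shows "pdet A S < (\<Prod>u\<in>N. A u u) * pdet A (S - N)"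
proof -
  have u: "u \<in> S" using assms by auto
  have "finite N" using assms(1,4) by (rule rev_finite_subset)
  have "pdet A S < A u u * pdet A (S - {u})"
    using assms u by (intro pdet_psd_remove_strict) auto
  also have "\<dots> \<le> A u u * ((\<Prod>u\<in>N - {u}. A u u) * pdet A (S - {u} - (N - {u})))"
    using assms u psd_on_diag[OF assms(2,1) u] psd_on_subset[OF assms(2)]
    by (intro mult_left_mono pdet_psd_fischer) auto
  also have "S - {u} - (N - {u}) = S - N" using assms(6) by auto
  finally show ?thesis using \<open>finite N\<close> assms(6) by (simp add: prod.remove mult_ac)
qed

text \<open>A symmetric matrix with a positive semidefinite principal submatrix of corank one has at most
  one negative eigenvalue.\<close>

lemma psd_on_if_pdet_pos:
  assumes "finite S" "symmetric_kernel A" "v \<in> S" "psd_on (S - {v}) A" "0 < pdet A S"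
  shows "psd_on S A"
  using assms
proof (induction "card S" arbitrary: S A)
  case (Suc n)
  show ?case
  proof (cases "S = {v}")
    case True
    then show ?thesis using pdet_unit_row[of S v A] Suc.prems by (auto simp: psd_on_def mult.assoc)
  next
    case False
    then obtain w where w: "w \<in> S" "w \<noteq> v" using Suc.prems by blast
    have "A w w \<ge> 0" using psd_on_diag[OF Suc.prems(4)] Suc.prems(1) w by simp
    have sw: "finite (S - {w})" "v \<in> S - {w}" "w \<in> S - {v}" using Suc.prems w by auto
    have eq: "S - {v} - {w} = S - {w} - {v}" by auto
    have psdvw: "psd_on (S - {w} - {v}) A"
      using psd_on_subset[OF Suc.prems(4), of "S - {w} - {v}"] Suc.prems(1) by auto
    have "A w w \<noteq> 0"
    proof
      \<comment> \<open>Row \<open>w\<close> now vanishes except possibly at \<open>v\<close>, so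
        the determinant is minus the square of \<open>A v w\<close> times a nonnegative minor, which
        contradicts its positivity.\<close>
      assume zero: "A w w = 0"
      then have row: "A w j = 0" if "j \<in> S - {v}" for j
        using psd_on_zero_diag[OF Suc.prems(4) _ sw(3) that symmetric_kernelD[OF Suc.prems(2)] zero]
        Suc.prems(1) by simp
      have col: "A i w = 0" if "i \<in> S - {v}" for i
        using row[OF that] symmetric_kernelD[OF Suc.prems(2), of i w] by simp
      have "A w v = A v w" using Suc.prems(2) by (rule symmetric_kernelD)
      \<comment> \<open>Adding 1 at the zero diagonal entry creates a usable pivot. The Schur
        complement at \<open>w\<close> then changes only the entry at \<open>v\<close>, which gives
        \<open>?C\<close>; expanding \<open>?B\<close> and \<open>?C\<close> by
        \<open>pdet_diag_add\<close> cancels the minor on \<open>S - {w}\<close>.\<close>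
      let ?B = "\<lambda>i j. A i j + (if i = w \<and> j = w then 1 else 0)"
      let ?C = "\<lambda>i j. A i j + (if i = v \<and> j = v then - (A v w)\<^sup>2 else 0)"
      have "pdet A S + pdet A (S - {w}) = pdet ?B S"
        using pdet_diag_add[OF Suc.prems(1) w(1), of A 1] by simp
      also have "\<dots> = pdet (schur ?B w) (S - {w})"
        using pdet_schur[OF Suc.prems(1) w(1), of ?B] zero by simp
      also have "\<dots> = pdet ?C (S - {w})"
      proof (rule pdet_cong)
        fix i j assume ij: "i \<in> S - {w}" "j \<in> S - {w}"
        show "schur ?B w i j = ?C i j"
        proof (cases "i = v \<and> j = v")
          case True
          then show ?thesis using w(2) zero \<open>A w v = A v w\<close> by (simp add: schur_def power2_eq_square)
        next
          case False
          then have "A i w * A w j = 0" using row[of j] col[of i] ij by auto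
          with False ij show ?thesis using zero by (auto simp: schur_def)
        qed
      qed
      also have "\<dots> = pdet A (S - {w}) - (A v w)\<^sup>2 * pdet A (S - {w} - {v})"
        using pdet_diag_add[OF sw(1,2)] by simp
      finally have "pdet A S = - ((A v w)\<^sup>2 * pdet A (S - {w} - {v}))" by simp
      moreover have "0 \<le> pdet A (S - {w} - {v})"
        using pdet_psd_nonneg[OF _ psdvw] Suc.prems by auto
      ultimately show False using Suc.prems(5) by (simp add: zero_less_mult_iff mult_less_0_iff)
    qed
    with \<open>A w w \<ge> 0\<close> have pos: "A w w > 0" by simp
    have "psd_on (S - {w}) (schur A w)"
    proof (rule Suc.hyps(1))
      show "psd_on (S - {w} - {v}) (schur A w)"
        using psd_on_schur_iff[OF _ sw(3) pos Suc.prems(2)] Suc.prems(1,4) by (simp add: eq)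
      show "0 < pdet (schur A w) (S - {w})"
        using pdet_schur[OF Suc.prems(1) w(1)] pos Suc.prems(5) by (simp add: zero_less_mult_iff)
      show "symmetric_kernel (schur A w)"
        using Suc.prems(2) by (rule symmetric_schur)
    qed (use Suc.hyps(2) Suc.prems(1) sw w in auto)
    then show ?thesis using psd_on_schur_iff[OF Suc.prems(1) w(1) pos Suc.prems(2)] by simp
  qed
qed simp

text \<open>The equality counterpart of \<open>pdet_psd_fischer\<close>, used for unions of
  cliques.\<close>

lemma pdet_diag_rows:
  assumes "finite S" "N \<subseteq> S" "\<And>u j. u \<in> N \<Longrightarrow> j \<in> S \<Longrightarrow> j \<noteq> u \<Longrightarrow> A u j = 0"
  shows "pdet A S = (\<Prod>u\<in>N. A u u) * pdet A (S - N)"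
proof -
  have "finite N" using assms(1,2) by (rule rev_finite_subset)
  then show ?thesis using assms(2,3)
  proof (induction N)
    case (insert u N)
    have "pdet A S = (\<Prod>u\<in>N. A u u) * pdet A (S - N)"
      by (rule insert.IH) (use insert.prems in auto)
    also have "pdet A (S - N) = A u u * pdet A (S - N - {u})"
      by (rule pdet_unit_row) (use insert.prems insert.hyps assms(1) in auto)
    also have "S - N - {u} = S - insert u N" by auto
    finally show ?case using insert.hyps by simp
  qed simp
qed

section \<open>The signless Laplace determinant and independent sets\<close>

text \<open>The diagonal \<open>d\<close> is a free parameter, because the inductions delete
  vertices while the diagonal keeps its values. Its link with degrees enters as the bound
  \<open>card (nbrs W i) \<le> d i\<close>.\<close>

locale weighted_graph =
  fixes adj :: "'v \<Rightarrow> 'v \<Rightarrow> bool" and d :: "'v \<Rightarrow> real"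
  assumes adj_sym: "adj u v \<Longrightarrow> adj v u" and adj_irrefl: "\<not> adj u u"
begin

definition laplace :: "'v \<Rightarrow> 'v \<Rightarrow> real" where
  "laplace i j = (if i = j then d i else of_bool (adj i j))"

definition indep :: "'v set \<Rightarrow> bool" where
  "indep S \<longleftrightarrow> (\<forall>u\<in>S. \<forall>v\<in>S. \<not> adj u v)"

definition nbrs :: "'v set \<Rightarrow> 'v \<Rightarrow> 'v set" where
  "nbrs W v = {u \<in> W. adj v u}"

text \<open>A weighted independence polynomial, the F of the overview.\<close>

definition ipoly :: "'v set \<Rightarrow> real" where
  "ipoly W = (\<Sum>S | S \<subseteq> W \<and> indep S. \<Prod>i\<in>W - S. d i - 1)"

text \<open>The Schur complement at \<open>v\<close> of the matrix that arises from \<open>laplace\<close> by replacing the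
  diagonal entry \<open>d v\<close> by 1.\<close>

definition pivoted :: "'v \<Rightarrow> 'v \<Rightarrow> 'v \<Rightarrow> real" where
  "pivoted v i j = laplace i j - of_bool (adj v i) * of_bool (adj v j)"

text \<open>Disjoint unions of cliques are the graphs without an induced path on three vertices.
  This form passes to subsets and, when it fails, hands over the path.\<close>

definition clique_union :: "'v set \<Rightarrow> bool" where
  "clique_union W \<longleftrightarrow> (\<forall>u\<in>W. \<forall>v\<in>W. \<forall>w\<in>W. adj v u \<longrightarrow> adj v w \<longrightarrow> u \<noteq> w \<longrightarrow> adj u w)"

section \<open>Matching recurrences for \<open>ipoly\<close> and the determinant\<close>

lemma symmetric_laplace: "symmetric_kernel laplace"
  unfolding symmetric_kernel_def laplace_def using adj_sym by auto

text \<open>Independent sets are split by whether they contain \<open>v\<close>; those that do avoid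
  \<open>nbrs W v\<close>, whose weights therefore all appear as factors.\<close>

lemma ipoly_rec:
  assumes "finite W" "v \<in> W"
  shows "ipoly W = (d v - 1) * ipoly (W - {v})
    + (\<Prod>u\<in>nbrs W v. d u - 1) * ipoly (W - {v} - nbrs W v)"
proof -
  let ?N = "nbrs W v" and ?f = "\<lambda>S. \<Prod>i\<in>W - S. d i - 1"
  let ?A = "{S. S \<subseteq> W - {v} \<and> indep S}" and ?B = "{S. S \<subseteq> W - {v} - ?N \<and> indep S}"
  have vN: "v \<notin> ?N" by (simp add: nbrs_def adj_irrefl)
  have finN: "finite ?N" using assms by (simp add: nbrs_def)
  have fin: "finite ?A" "finite ?B" using assms by auto
  have split: "{S. S \<subseteq> W \<and> indep S} = ?A \<union> insert v ` ?B"
  proof (intro equalityI subsetI)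
    fix S assume S: "S \<in> {S. S \<subseteq> W \<and> indep S}"
    show "S \<in> ?A \<union> insert v ` ?B"
    proof (cases "v \<in> S")
      case True
      then have "S = insert v (S - {v})" by auto
      moreover have "S - {v} \<in> ?B" using S True by (auto simp: indep_def nbrs_def)
      ultimately show ?thesis by blast
    qed (use S in auto)
  next
    fix S assume "S \<in> ?A \<union> insert v ` ?B"
    then show "S \<in> {S. S \<subseteq> W \<and> indep S}"
      using assms(2) adj_sym adj_irrefl by (auto simp: indep_def nbrs_def)
  qed
  have inj: "inj_on (insert v) ?B"
    by (rule inj_onI) (auto simp: insert_ident)
  have "ipoly W = (\<Sum>S\<in>?A. ?f S) + (\<Sum>S\<in>insert v ` ?B. ?f S)"
    unfolding ipoly_def split by (rule sum.union_disjoint) (use fin in auto)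
  also have "(\<Sum>S\<in>?A. ?f S) = (\<Sum>S\<in>?A. (d v - 1) * (\<Prod>i\<in>W - {v} - S. d i - 1))"
  proof (rule sum.cong[OF refl])
    fix S assume "S \<in> ?A"
    then have "v \<in> W - S" "W - S - {v} = W - {v} - S" using assms by auto
    then show "?f S = (d v - 1) * (\<Prod>i\<in>W - {v} - S. d i - 1)"
      using assms prod.remove[of "W - S" v "\<lambda>i. d i - 1"] by simp
  qed
  also have "(\<Sum>S\<in>insert v ` ?B. ?f S)
      = (\<Sum>S\<in>?B. (\<Prod>u\<in>?N. d u - 1) * (\<Prod>i\<in>W - {v} - ?N - S. d i - 1))"
    unfolding sum.reindex[OF inj] comp_def
  proof (rule sum.cong[OF refl])
    fix S assume "S \<in> ?B"
    then have "W - insert v S = ?N \<union> (W - {v} - ?N - S)"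
      using vN by (auto simp: nbrs_def)
    then show "?f (insert v S) = (\<Prod>u\<in>?N. d u - 1) * (\<Prod>i\<in>W - {v} - ?N - S. d i - 1)"
      using finN assms(1) by (simp only:) (rule prod.union_disjoint, auto)
  qed
  finally show ?thesis by (simp add: ipoly_def sum_distrib_left)
qed

text \<open>Splitting \<open>d v\<close> as \<open>(d v - 1) + 1\<close> isolates the coefficient
  that occurs in \<open>ipoly_rec\<close>. The remaining pivot 1 makes the Schur complement free of
  division and gives it the entries \<open>d u - 1\<close> at the neighbours of \<open>v\<close>,
  again as in \<open>ipoly_rec\<close>.\<close>

definition unit_diag :: "'v \<Rightarrow> 'v \<Rightarrow> 'v \<Rightarrow> real" where
  "unit_diag v i j = laplace i j + (if i = v \<and> j = v then 1 - d v else 0)"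

lemma unit_diag_diag: "unit_diag v v v = 1"
  by (simp add: unit_diag_def laplace_def)

lemma symmetric_unit_diag: "symmetric_kernel (unit_diag v)"
  using symmetric_laplace unfolding symmetric_kernel_def unit_diag_def by simp

lemma schur_unit_diag: "i \<noteq> v \<Longrightarrow> j \<noteq> v \<Longrightarrow> schur (unit_diag v) v i j = pivoted v i j"
  unfolding schur_def unit_diag_diag using adj_sym by (auto simp: unit_diag_def pivoted_def laplace_def)

lemma pdet_unit_diag: "finite W \<Longrightarrow> v \<in> W \<Longrightarrow> pdet (unit_diag v) W = pdet (pivoted v) (W - {v})"
  using pdet_schur[of W v "unit_diag v"] pdet_cong[of "W - {v}" "schur (unit_diag v) v" "pivoted v"]
  by (simp add: unit_diag_diag schur_unit_diag)

lemma pdet_rec: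
  assumes "finite W" "v \<in> W"
  shows "pdet laplace W = (d v - 1) * pdet laplace (W - {v}) + pdet (pivoted v) (W - {v})"
proof -
  have "pdet (unit_diag v) W = pdet laplace W + (1 - d v) * pdet laplace (W - {v})"
    using pdet_diag_add[OF assms, of laplace "1 - d v"] by (simp add: unit_diag_def[abs_def])
  then show ?thesis using pdet_unit_diag[OF assms] by (simp add: algebra_simps)
qed

lemma pivoted_nbr_diag: "u \<in> nbrs W v \<Longrightarrow> pivoted v u u = d u - 1"
  by (simp add: pivoted_def laplace_def nbrs_def)

lemma pdet_pivoted_outside: "pdet (pivoted v) (W - {v} - nbrs W v) = pdet laplace (W - {v} - nbrs W v)"
  by (rule pdet_cong) (auto simp: pivoted_def nbrs_def)

lemma clique_union_subset: "clique_union W \<Longrightarrow> U \<subseteq> W \<Longrightarrow> clique_union U"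
  unfolding clique_union_def by blast

lemma pdet_eq_ipoly_if_clique_union:
  assumes "finite W" "clique_union W"
  shows "pdet laplace W = ipoly W"
  using assms
proof (induction W rule: finite_psubset_induct)
  case (psubset W)
  show ?case
  proof (cases "W = {}")
    case True
    have "{S. S \<subseteq> {} \<and> indep S} = {{}}" by (auto simp: indep_def)
    then show ?thesis using True by (simp add: ipoly_def)
  next
    case False
    then obtain v where v: "v \<in> W" by blast
    let ?N = "nbrs W v"
    have IH: "pdet laplace U = ipoly U" if "U \<subset> W" for U
      using psubset.IH[OF that] clique_union_subset[OF psubset.prems] that by blast
    have "pdet (pivoted v) (W - {v}) = (\<Prod>u\<in>?N. pivoted v u u) * pdet (pivoted v) (W - {v} - ?N)"
    proof (rule pdet_diag_rows)
      show "?N \<subseteq> W - {v}" using adj_irrefl by (auto simp: nbrs_def)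
      fix u j assume uj: "u \<in> ?N" "j \<in> W - {v}" "j \<noteq> u"
      then have u: "u \<in> W" "adj v u" "adj u v" using adj_sym by (auto simp: nbrs_def)
      \<comment> \<open>Adjacent vertices of a clique have the same other neighbours, so the
        subtracted product cancels the entry of \<open>laplace\<close>.\<close>
      have "adj u j \<longleftrightarrow> adj v j"
      proof
        assume "adj u j"
        then show "adj v j"
          using psubset.prems u uj v unfolding clique_union_def by blast
      next
        assume "adj v j"
        then show "adj u j"
          using psubset.prems u uj v unfolding clique_union_def by blast
      qed
      then show "pivoted v u j = 0" using uj u by (simp add: pivoted_def laplace_def)
    qed (use psubset.hyps in auto)
    also have "\<dots> = (\<Prod>u\<in>?N. d u - 1) * ipoly (W - {v} - ?N)"
    proof -
      have "W - {v} - ?N \<subset> W" using v by auto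
      then show ?thesis by (simp add: pdet_pivoted_outside IH pivoted_nbr_diag)
    qed
    finally show ?thesis
      using pdet_rec[OF psubset.hyps v] ipoly_rec[OF psubset.hyps v] IH[of "W - {v}"] v by auto
  qed
qed

section \<open>The inequality between determinant and \<open>ipoly\<close>, and its strict
  form\<close>

lemma psd_laplace:
  assumes "finite W" "\<And>i. i \<in> W \<Longrightarrow> card (nbrs W i) \<le> d i"
  shows "psd_on W laplace"
  unfolding psd_on_def
proof
  fix x :: "'v \<Rightarrow> real"
  let ?a = "\<lambda>i j. of_bool (adj i j) :: real"
  let ?D = "\<Sum>i\<in>W. real (card (nbrs W i)) * (x i)\<^sup>2"
  let ?T = "\<Sum>i\<in>W. \<Sum>j\<in>W. ?a i j * x i * x j"
  have deg: "(\<Sum>j\<in>W. ?a i j) = real (card (nbrs W i))" for i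
    using assms(1) by (simp add: of_bool_def sum.If_cases nbrs_def Int_def)
  have row: "(\<Sum>i\<in>W. \<Sum>j\<in>W. ?a i j * (x i)\<^sup>2) = ?D"
    unfolding deg[symmetric] sum_distrib_right ..
  have "(\<Sum>i\<in>W. \<Sum>j\<in>W. ?a i j * (x j)\<^sup>2) = (\<Sum>j\<in>W. \<Sum>i\<in>W. ?a i j * (x j)\<^sup>2)"
    by (rule sum.swap)
  also have "\<dots> = (\<Sum>j\<in>W. \<Sum>i\<in>W. ?a j i * (x j)\<^sup>2)"
    by (intro sum.cong refl arg_cong2[where f="(*)"]) (use adj_sym in auto)
  finally have col: "(\<Sum>i\<in>W. \<Sum>j\<in>W. ?a i j * (x j)\<^sup>2) = ?D" using row by simp
  \<comment> \<open>Each edge contributes the square of \<open>x i + x j\<close>, counted in both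
    directions. The surplus of \<open>d i\<close> over the number of neighbours in \<open>W\<close>
    only adds nonnegative squares.\<close>
  have "0 \<le> (\<Sum>i\<in>W. \<Sum>j\<in>W. ?a i j * (x i + x j)\<^sup>2)"
    by (intro sum_nonneg) simp
  also have "\<dots> = (\<Sum>i\<in>W. \<Sum>j\<in>W. ?a i j * (x i)\<^sup>2 + ?a i j * (x j)\<^sup>2 + 2 * (?a i j * x i * x j))"
    by (intro sum.cong refl) (simp add: power2_eq_square algebra_simps)
  also have "\<dots> = 2 * ?D + 2 * ?T"
    unfolding sum.distrib row col sum_distrib_left[symmetric] by simp
  finally have "0 \<le> ?D + ?T" by simp
  also have "\<dots> \<le> (\<Sum>i\<in>W. d i * (x i)\<^sup>2) + ?T"
    using assms(2) by (intro add_right_mono sum_mono mult_right_mono) auto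
  also have "\<dots> = (\<Sum>i\<in>W. \<Sum>j\<in>W. (if i = j then d i * x i * x j else 0) + ?a i j * x i * x j)"
    using assms(1) by (simp add: sum.distrib power2_eq_square mult.assoc)
  also have "\<dots> = (\<Sum>i\<in>W. \<Sum>j\<in>W. laplace i j * x i * x j)"
    by (intro sum.cong refl) (simp add: laplace_def adj_irrefl)
  finally show "0 \<le> (\<Sum>i\<in>W. \<Sum>j\<in>W. laplace i j * x i * x j)" .
qed

text \<open>\<open>unit_diag v\<close> agrees with \<open>laplace\<close> off \<open>v\<close> and,
  having pivot 1, has the same determinant as \<open>pivoted v\<close>. So
  \<open>psd_on_if_pdet_pos\<close> applies to it, and semidefiniteness descends to the Schur
  complement.\<close>

lemma psd_pivoted_if_pdet_pos:
  assumes "finite W" "v \<in> W" "psd_on (W - {v}) laplace" "0 < pdet (pivoted v) (W - {v})"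
  shows "psd_on (W - {v}) (pivoted v)"
proof -
  have "psd_on (W - {v}) (unit_diag v) \<longleftrightarrow> psd_on (W - {v}) laplace"
    unfolding psd_on_def by (intro all_cong1 arg_cong2[where f="(\<le>)"] refl sum.cong) (auto simp: unit_diag_def)
  then have "psd_on W (unit_diag v)"
    using psd_on_if_pdet_pos[OF assms(1) symmetric_unit_diag assms(2)] assms pdet_unit_diag by auto
  then have "psd_on (W - {v}) (schur (unit_diag v) v)"
    using psd_on_schur_iff[OF assms(1,2) _ symmetric_unit_diag] by (simp add: unit_diag_diag)
  moreover have "psd_on (W - {v}) (schur (unit_diag v) v) \<longleftrightarrow> psd_on (W - {v}) (pivoted v)"
    unfolding psd_on_def by (intro all_cong1 arg_cong2[where f="(\<le>)"] refl sum.cong) (auto simp: schur_unit_diag)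
  ultimately show ?thesis by simp
qed

lemma symmetric_pivoted: "symmetric_kernel (pivoted v)"
  using symmetric_laplace unfolding symmetric_kernel_def pivoted_def by simp

lemma nbrs_subset: "nbrs W v \<subseteq> W - {v}"
  using adj_irrefl by (auto simp: nbrs_def)

lemma prod_nbrs_nonneg:
  "(\<And>i. i \<in> W \<Longrightarrow> 1 \<le> d i) \<Longrightarrow> 0 \<le> (\<Prod>u\<in>nbrs W v. d u - 1)"
  by (intro prod_nonneg) (auto simp: nbrs_def)

lemma pdet_pivoted_le:
  assumes "finite W" "v \<in> W" "psd_on (W - {v}) laplace" "\<And>i. i \<in> W \<Longrightarrow> 1 \<le> d i"
  shows "pdet (pivoted v) (W - {v}) \<le> (\<Prod>u\<in>nbrs W v. d u - 1) * pdet laplace (W - {v} - nbrs W v)"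
proof (cases "0 < pdet (pivoted v) (W - {v})")
  case True
  have "pdet (pivoted v) (W - {v}) \<le> (\<Prod>u\<in>nbrs W v. pivoted v u u) * pdet (pivoted v) (W - {v} - nbrs W v)"
    using psd_pivoted_if_pdet_pos[OF assms(1-3) True] symmetric_pivoted nbrs_subset assms(1)
    by (intro pdet_psd_fischer) auto
  then show ?thesis by (simp add: pivoted_nbr_diag pdet_pivoted_outside)
next
  case False
  \<comment> \<open>Here \<open>pivoted v\<close> may be indefinite, but a nonnegative right-hand
    side suffices.\<close>
  have "0 \<le> pdet laplace (W - {v} - nbrs W v)"
    using assms(1) psd_on_subset[OF assms(3)] symmetric_laplace by (intro pdet_psd_nonneg) auto
  then have "0 \<le> (\<Prod>u\<in>nbrs W v. d u - 1) * pdet laplace (W - {v} - nbrs W v)"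
    using prod_nbrs_nonneg[OF assms(4)] by simp
  with False show ?thesis by simp
qed

lemma pdet_le_ipoly:
  assumes "finite W" "psd_on W laplace" "\<And>i. i \<in> W \<Longrightarrow> 1 \<le> d i"
  shows "pdet laplace W \<le> ipoly W"
  using assms
proof (induction W rule: finite_psubset_induct)
  case (psubset W)
  show ?case
  proof (cases "W = {}")
    case True
    then show ?thesis
      using pdet_eq_ipoly_if_clique_union[of "{}"] by (simp add: clique_union_def)
  next
    case False
    then obtain v where v: "v \<in> W" by blast
    let ?N = "nbrs W v"
    have IH: "pdet laplace U \<le> ipoly U" if "U \<subset> W" for U
      using psubset.IH[OF that] psd_on_subset[OF psubset.prems(1) _ psubset.hyps] psubset.prems(2) that
      by blast
    have psdv: "psd_on (W - {v}) laplace"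
      using psd_on_subset[OF psubset.prems(1) _ psubset.hyps] by auto
    have "pdet (pivoted v) (W - {v}) \<le> (\<Prod>u\<in>?N. d u - 1) * pdet laplace (W - {v} - ?N)"
      by (rule pdet_pivoted_le[OF psubset.hyps v psdv psubset.prems(2)])
    also have "\<dots> \<le> (\<Prod>u\<in>?N. d u - 1) * ipoly (W - {v} - ?N)"
    proof (rule mult_left_mono)
      show "pdet laplace (W - {v} - ?N) \<le> ipoly (W - {v} - ?N)" using v by (intro IH) auto
      show "0 \<le> (\<Prod>u\<in>?N. d u - 1)" using psubset.prems(2) by (rule prod_nbrs_nonneg)
    qed
    finally have "pdet (pivoted v) (W - {v}) \<le> (\<Prod>u\<in>?N. d u - 1) * ipoly (W - {v} - ?N)" .
    moreover have "(d v - 1) * pdet laplace (W - {v}) \<le> (d v - 1) * ipoly (W - {v})"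
      using IH v psubset.prems(2) by (intro mult_left_mono) auto
    ultimately show ?thesis
      using pdet_rec[OF psubset.hyps v] ipoly_rec[OF psubset.hyps v] by simp
  qed
qed

text \<open>A nonzero summand must have every vertex with \<open>d i = 1\<close> in
  \<open>S\<close>. Taking exactly these vertices leaves only positive factors.\<close>

lemma ipoly_pos:
  assumes "finite W" "\<And>i. i \<in> W \<Longrightarrow> 1 \<le> d i" "indep {i \<in> W. d i = 1}"
  shows "0 < ipoly W"
  unfolding ipoly_def
proof (rule sum_pos2)
  show "{i \<in> W. d i = 1} \<in> {S. S \<subseteq> W \<and> indep S}" using assms by auto
  show "0 < (\<Prod>i\<in>W - {i \<in> W. d i = 1}. d i - 1)"
    using assms(2) by (intro prod_pos) force
  show "0 \<le> (\<Prod>i\<in>W - S. d i - 1)" for S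
    using assms(2) by (intro prod_nonneg) auto
qed (use assms in auto)

text \<open>Slack in the second term of the recurrence is enough, since the first is bounded by
  \<open>pdet_le_ipoly\<close>. The entry at \<open>u\<close> and \<open>w\<close> may be -1, for
  two nonadjacent neighbours of the pivot, or 1, for a neighbour joined to a non-neighbour; both
  cases occur below.\<close>

lemma pdet_less_ipoly:
  assumes "finite W" "psd_on W laplace" "\<And>i. i \<in> W \<Longrightarrow> 1 \<le> d i" "indep {i \<in> W. d i = 1}"
    and "v \<in> W" "\<And>x. x \<in> nbrs W v \<Longrightarrow> 1 < d x"
    and "u \<in> nbrs W v" "w \<in> W" "w \<noteq> v" "w \<noteq> u" "pivoted v u w \<noteq> 0"
  shows "pdet laplace W < ipoly W"
proof -
  let ?N = "nbrs W v"
  have psd: "psd_on U laplace" if "U \<subseteq> W" for U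
    using psd_on_subset[OF assms(2) that assms(1)] .
  have pos: "0 < (\<Prod>u\<in>?N. d u - 1)"
    using assms(6) by (intro prod_pos) auto
  have ipos: "0 < ipoly (W - {v} - ?N)"
    using assms(1,3,4) by (intro ipoly_pos) (auto simp: indep_def)
  have less: "pdet (pivoted v) (W - {v}) < (\<Prod>u\<in>?N. d u - 1) * ipoly (W - {v} - ?N)"
  proof (cases "0 < pdet (pivoted v) (W - {v})")
    case True
    have "pdet (pivoted v) (W - {v}) < (\<Prod>u\<in>?N. pivoted v u u) * pdet (pivoted v) (W - {v} - ?N)"
    proof (rule pdet_psd_fischer_strict)
      show "psd_on (W - {v}) (pivoted v)"
        by (rule psd_pivoted_if_pdet_pos[OF assms(1,5) _ True]) (use psd in auto)
      show "symmetric_kernel (pivoted v)" by (rule symmetric_pivoted)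
      show "?N \<subseteq> W - {v}" by (rule nbrs_subset)
    qed (use assms True in auto)
    also have "\<dots> = (\<Prod>u\<in>?N. d u - 1) * pdet laplace (W - {v} - ?N)"
      by (simp add: pivoted_nbr_diag pdet_pivoted_outside)
    also have "\<dots> \<le> (\<Prod>u\<in>?N. d u - 1) * ipoly (W - {v} - ?N)"
    proof (rule mult_left_mono)
      show "pdet laplace (W - {v} - ?N) \<le> ipoly (W - {v} - ?N)"
        by (rule pdet_le_ipoly[OF _ psd]) (use assms(1,3) in auto)
    qed (use pos in simp)
    finally show ?thesis .
  next
    case False
    \<comment> \<open>A nonpositive determinant lies strictly below the positive right-hand
      side.\<close>
    then show ?thesis using mult_pos_pos[OF pos ipos] by simp
  qed
  have "pdet laplace (W - {v}) \<le> ipoly (W - {v})"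
    by (rule pdet_le_ipoly) (use psd assms(1,3) in auto)
  then have "(d v - 1) * pdet laplace (W - {v}) \<le> (d v - 1) * ipoly (W - {v})"
    using assms(3,5) by (intro mult_left_mono) auto
  with less show ?thesis
    using pdet_rec[OF assms(1,5)] ipoly_rec[OF assms(1,5)] by simp
qed

text \<open>An induced path centred at \<open>v\<close> yields strictness with pivot
  \<open>v\<close> unless some neighbour of \<open>v\<close> has degree 1, which would make the
  product over the neighbours vanish. The second case changes the pivot.\<close>

lemma clique_union_if_pdet_eq_ipoly:
  assumes "finite W" "\<And>i. i \<in> W \<Longrightarrow> 1 \<le> d i" "indep {i \<in> W. d i = 1}"
    and "\<And>i. i \<in> W \<Longrightarrow> card (nbrs W i) \<le> d i"
    and "pdet laplace W = ipoly W"
  shows "clique_union W"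
proof (rule ccontr)
  assume "\<not> clique_union W"
  then obtain u v w where uvw: "u \<in> W" "v \<in> W" "w \<in> W" "adj v u" "adj v w" "u \<noteq> w" "\<not> adj u w"
    unfolding clique_union_def by blast
  have psd: "psd_on W laplace" using psd_laplace[OF assms(1,4)] .
  show False
  proof (cases "\<forall>x\<in>nbrs W v. 1 < d x")
    case True
    have "pivoted v u w \<noteq> 0" using uvw by (simp add: pivoted_def laplace_def)
    then have "pdet laplace W < ipoly W"
      using uvw True assms(1-3) psd adj_irrefl
      by (intro pdet_less_ipoly[of W v u w]) (auto simp: nbrs_def)
    then show False using assms(5) by simp
  next
    case False
    then obtain x where "x \<in> nbrs W v" and nless: "\<not> 1 < d x" by blast
    then have xW: "x \<in> W" and adj_x: "adj v x" by (simp_all add: nbrs_def)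
    have "d x = 1" using assms(2)[OF xW] nless by simp
    moreover have "x \<noteq> v" using adj_x adj_irrefl by metis
    ultimately have x: "x \<in> W" "adj v x" "adj x v" "d x = 1" "x \<noteq> v"
      using xW adj_x adj_sym[OF adj_x] by simp_all
    \<comment> \<open>\<open>v\<close> is the only neighbour of \<open>x\<close>, so \<open>x\<close> serves as the pivot instead of \<open>v\<close>.\<close>
    have "card (nbrs W x) \<le> 1" using assms(4)[OF x(1)] x(4) by simp
    moreover have v: "v \<in> nbrs W x" and "finite (nbrs W x)"
      using x uvw assms(1) by (simp_all add: nbrs_def)
    ultimately have "y = v" if "y \<in> nbrs W x" for y
      using that card_le_Suc0_iff_eq[of "nbrs W x"] by simp
    with v have nx: "nbrs W x = {v}" by blast
    \<comment> \<open>Otherwise \<open>v\<close> and \<open>x\<close> would be adjacent vertices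
      with diagonal value 1.\<close>
    have "d v \<noteq> 1" using assms(3) x uvw unfolding indep_def by blast
    then have dv: "1 < d v" using assms(2)[OF uvw(2)] by simp
    \<comment> \<open>One of \<open>u\<close> and \<open>w\<close> differs from
      \<open>x\<close>.\<close>
    obtain y where y: "y \<in> W" "adj v y" "y \<noteq> x" using uvw by metis
    have yv: "y \<noteq> v" using y adj_irrefl by auto
    then have "\<not> adj x y" using nx y by (auto simp: nbrs_def)
    then have "pivoted x v y \<noteq> 0" using y yv by (simp add: pivoted_def laplace_def)
    then have "pdet laplace W < ipoly W"
      using x y yv nx dv assms(1-3) psd
      by (intro pdet_less_ipoly[of W x v y]) auto
    then show False using assms(5) by simp
  qed
qed

text \<open>The summand of \<open>ipoly\<close> at \<open>S\<close> counts the functions that take their largest admissible value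
  exactly on \<open>S\<close>. An index with \<open>m i = 0\<close>, where that value is junk, has no neighbours, and both sides
  vanish.\<close>

lemma card_bounded_functions:
  assumes "finite W" "\<And>i. i \<in> W \<Longrightarrow> d i = real (m i)" "\<And>i. i \<in> W \<Longrightarrow> card (nbrs W i) \<le> m i"
  shows "real (card {b \<in> PiE W (\<lambda>i. {..<m i}). indep {i \<in> W. b i = m i - 1}}) = ipoly W"
proof (cases "\<exists>i\<in>W. m i = 0")
  case True
  then obtain v where v: "v \<in> W" "m v = 0" by blast
  then have "PiE W (\<lambda>i. {..<m i}) = {}" by (auto simp: PiE_eq_empty_iff)
  moreover have "nbrs W v = {}"
    using assms(3)[OF v(1)] v(2) assms(1) by (simp add: nbrs_def)
  then have "ipoly W = 0"
    using ipoly_rec[OF assms(1) v(1)] assms(2)[OF v(1)] v(2) by simp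
  ultimately show ?thesis by simp
next
  case False
  let ?P = "\<lambda>S. PiE W (\<lambda>i. if i \<in> S then {m i - 1} else {..<m i - 1})"
  let ?I = "{S. S \<subseteq> W \<and> indep S}"
  \<comment> \<open>\<open>S\<close> can be read off from any member of \<open>?P S\<close>, so
    these product sets are pairwise disjoint.\<close>
  have max: "{i \<in> W. b i = m i - 1} = S" if "b \<in> ?P S" "S \<subseteq> W" for b S
  proof -
    have b: "b i \<in> (if i \<in> S then {m i - 1} else {..<m i - 1})" if "i \<in> W" for i
      using \<open>b \<in> ?P S\<close> that by (rule PiE_mem)
    show ?thesis using b \<open>S \<subseteq> W\<close> by (fastforce split: if_splits)
  qed
  have "{b \<in> PiE W (\<lambda>i. {..<m i}). indep {i \<in> W. b i = m i - 1}} = (\<Union>S\<in>?I. ?P S)"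
  proof (intro equalityI subsetI)
    fix b assume b: "b \<in> {b \<in> PiE W (\<lambda>i. {..<m i}). indep {i \<in> W. b i = m i - 1}}"
    have "b \<in> ?P {i \<in> W. b i = m i - 1}"
    proof (rule PiE_I)
      fix i assume i: "i \<in> W"
      then have "b i < m i" using b PiE_mem[of b W "\<lambda>i. {..<m i}" i] by simp
      with i show "b i \<in> (if i \<in> {i \<in> W. b i = m i - 1} then {m i - 1} else {..<m i - 1})"
        by auto
    next
      fix i assume "i \<notin> W"
      then show "b i = undefined" using b PiE_arb[of b W "\<lambda>i. {..<m i}" i] by simp
    qed
    moreover have "{i \<in> W. b i = m i - 1} \<in> ?I" using b by simp
    ultimately show "b \<in> (\<Union>S\<in>?I. ?P S)" by (rule UN_I[rotated])
  next
    fix b assume "b \<in> (\<Union>S\<in>?I. ?P S)"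
    then obtain S where S: "S \<in> ?I" "b \<in> ?P S" by (rule UN_E)
    have "b \<in> PiE W (\<lambda>i. {..<m i})"
    proof (rule PiE_I)
      fix i assume i: "i \<in> W"
      then have "0 < m i" using False by simp
      moreover have "b i \<in> (if i \<in> S then {m i - 1} else {..<m i - 1})"
        using S(2) i by (rule PiE_mem)
      ultimately show "b i \<in> {..<m i}" by (cases "i \<in> S") auto
    next
      fix i assume "i \<notin> W"
      with S(2) show "b i = undefined" by (rule PiE_arb)
    qed
    with S max[OF S(2)] show "b \<in> {b \<in> PiE W (\<lambda>i. {..<m i}). indep {i \<in> W. b i = m i - 1}}" by simp
  qed
  moreover have "card (\<Union>S\<in>?I. ?P S) = (\<Sum>S\<in>?I. card (?P S))"
  proof (rule card_UN_disjoint)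
    show "\<forall>S\<in>?I. finite (?P S)" using assms(1) by (auto intro!: finite_PiE)
    show "\<forall>S\<in>?I. \<forall>T\<in>?I. S \<noteq> T \<longrightarrow> ?P S \<inter> ?P T = {}"
    proof (intro ballI impI equals0I)
      fix S T b assume ST: "S \<in> ?I" "T \<in> ?I" "S \<noteq> T" "b \<in> ?P S \<inter> ?P T"
      then have "{i \<in> W. b i = m i - 1} = S" "{i \<in> W. b i = m i - 1} = T"
        using max[of b S] max[of b T] by simp_all
      with ST(3) show False by simp
    qed
  qed (use assms(1) in auto)
  moreover have "real (\<Sum>S\<in>?I. card (?P S)) = ipoly W"
    unfolding ipoly_def of_nat_sum
  proof (rule sum.cong[OF refl])
    fix S assume "S \<in> ?I"
    then have SW: "S \<subseteq> W" by simp
    have "card (?P S) = (\<Prod>i\<in>W. if i \<in> S then 1 else m i - 1)"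
      using assms(1) by (auto simp: card_PiE intro: prod.cong)
    also have "\<dots> = (\<Prod>i\<in>W - S. m i - 1)"
      using assms(1) by (simp add: prod.If_cases Diff_eq)
    also have "real \<dots> = (\<Prod>i\<in>W - S. d i - 1)"
      unfolding of_nat_prod
    proof (rule prod.cong[OF refl])
      fix i assume "i \<in> W - S"
      then have "m i \<ge> 1" "d i = real (m i)" using False assms(2) by auto
      then show "real (m i - 1) = d i - 1" by (simp add: of_nat_diff)
    qed
    finally show "real (card (?P S)) = (\<Prod>i\<in>W - S. d i - 1)" .
  qed
  ultimately show ?thesis by simp
qed

end

section \<open>Monomial ideals\<close>

definition mons :: "nat \<Rightarrow> (nat \<Rightarrow>\<^sub>0 nat) set" where
  "mons n = {m. Poly_Mapping.keys m \<subseteq> {1..n}}"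

text \<open>The linear span of the monomials in \<open>U\<close>. This one notion serves for the
  ring, for monomial ideals and for the span of the standard monomials.\<close>

definition supported :: "(nat \<Rightarrow>\<^sub>0 nat) set \<Rightarrow> 'k::field mpoly set" where
  "supported U = {p. Poly_Mapping.keys p \<subseteq> U}"

definition multiples :: "nat \<Rightarrow> (nat \<Rightarrow>\<^sub>0 nat) set \<Rightarrow> (nat \<Rightarrow>\<^sub>0 nat) set" where
  "multiples n E = {m \<in> mons n. \<exists>g\<in>E. \<exists>h. m = g + h}"

lemma zero_in_mons [simp]: "0 \<in> mons n"
  by (simp add: mons_def)

text \<open>Natural exponents cannot cancel; the forward direction puts the cofactor of a multiple
  back into the ring.\<close>

lemma add_in_mons_iff: "f + g \<in> mons n \<longleftrightarrow> f \<in> mons n \<and> g \<in> mons n"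
  by (auto simp: mons_def in_keys_iff lookup_add subset_iff)

lemma multiples_add: "f \<in> mons n \<Longrightarrow> m \<in> multiples n E \<Longrightarrow> f + m \<in> multiples n E"
  unfolding multiples_def by (auto simp: add_in_mons_iff) (metis add.left_commute)

lemma times_supported:
  assumes "p \<in> supported A" "q \<in> supported B" "\<And>f g. f \<in> A \<Longrightarrow> g \<in> B \<Longrightarrow> f + g \<in> C"
  shows "p * q \<in> supported C"
  unfolding supported_def mem_Collect_eq
proof
  fix m assume "m \<in> Poly_Mapping.keys (p * q)"
  then obtain f g where "m = f + g" "f \<in> Poly_Mapping.keys p" "g \<in> Poly_Mapping.keys q"
    using keys_mult[of p q] by blast
  then show "m \<in> C" using assms by (auto simp: supported_def)
qed

lemma zero_supported [simp]: "0 \<in> supported U"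
  by (simp add: supported_def)

lemma single_supported: "m \<in> U \<Longrightarrow> Poly_Mapping.single m c \<in> supported U"
  by (simp add: supported_def)

lemma add_supported: "p \<in> supported U \<Longrightarrow> q \<in> supported U \<Longrightarrow> p + q \<in> supported U"
  using Poly_Mapping.keys_add[of p q] by (auto simp: supported_def)

lemma uminus_supported: "p \<in> supported U \<Longrightarrow> - p \<in> supported U"
  by (simp add: supported_def)

lemma mult_supported: "p \<in> supported (mons n) \<Longrightarrow> q \<in> supported (mons n) \<Longrightarrow> p * q \<in> supported (mons n)"
  by (erule (1) times_supported) (simp add: add_in_mons_iff)

lemma remove_monomial_supported:
  assumes "p \<in> supported (insert m T)"
  shows "p - Poly_Mapping.single m (Poly_Mapping.lookup p m) \<in> supported T"
  unfolding supported_def mem_Collect_eq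
proof
  fix x assume x: "x \<in> Poly_Mapping.keys (p - Poly_Mapping.single m (Poly_Mapping.lookup p m))"
  then have "x \<noteq> m" by (auto simp: in_keys_iff lookup_minus)
  with x have "x \<in> Poly_Mapping.keys p" by (simp add: in_keys_iff lookup_minus lookup_single_not_eq)
  with \<open>x \<noteq> m\<close> show "x \<in> T" using assms by (auto simp: supported_def)
qed

lemma supported_mono: "U \<subseteq> V \<Longrightarrow> supported U \<subseteq> supported V"
  by (auto simp: supported_def)

lemma poly_ring_simps [simp]:
  "carrier (poly_ring n) = supported (mons n)"
  "monoid.mult (poly_ring n) = (*)" "one (poly_ring n) = 1" "zero (poly_ring n) = 0" "add (poly_ring n) = (+)"
  by (auto simp: poly_ring_def supported_def mons_def)

lemma one_supported: "1 \<in> supported (mons n)"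
  by (simp add: supported_def)

lemma cring_poly_ring: "cring (poly_ring n :: 'k::field mpoly ring)"
proof (rule cringI)
  show "abelian_group (poly_ring n :: 'k mpoly ring)"
  proof (rule abelian_groupI)
    fix p :: "'k mpoly" assume "p \<in> carrier (poly_ring n)"
    then show "\<exists>q\<in>carrier (poly_ring n). q \<oplus>\<^bsub>poly_ring n\<^esub> p = \<zero>\<^bsub>poly_ring n\<^esub>"
      by (intro bexI[of _ "- p"]) (simp_all add: uminus_supported)
  qed (simp_all add: add_supported add_ac)
  show "comm_monoid (poly_ring n :: 'k mpoly ring)"
    by (rule comm_monoidI) (simp_all add: mult_supported one_supported mult_ac)
qed (simp add: distrib_right)

lemma a_inv_poly_ring:
  assumes "p \<in> supported (mons n)"
  shows "a_inv (poly_ring n) p = - p"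
proof -
  interpret cring "poly_ring n" by (rule cring_poly_ring)
  show ?thesis using minus_equality[of "- p" p] assms by (simp add: uminus_supported)
qed

lemma ideal_supported_multiples:
  "ideal (supported (multiples n E)) (poly_ring n :: 'k::field mpoly ring)"
proof -
  interpret cring "poly_ring n :: 'k mpoly ring" by (rule cring_poly_ring)
  have sub: "supported (multiples n E) \<subseteq> (supported (mons n) :: 'k mpoly set)"
    by (rule supported_mono) (auto simp: multiples_def)
  have mult: "p * q \<in> supported (multiples n E)"
    if "p \<in> supported (mons n)" "q \<in> supported (multiples n E)" for p q :: "'k mpoly"
    using that by (rule times_supported) (rule multiples_add)
  show ?thesis
  proof (rule idealI)
    show "ring (poly_ring n :: 'k mpoly ring)" by (rule ring_axioms)
    show "subgroup (supported (multiples n E)) (add_monoid (poly_ring n :: 'k mpoly ring))"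
    proof (rule add.subgroupI)
      fix p :: "'k mpoly" assume "p \<in> supported (multiples n E)"
      then show "\<ominus>\<^bsub>poly_ring n\<^esub> p \<in> supported (multiples n E)"
        using sub by (subst a_inv_poly_ring) (auto simp: uminus_supported)
    next
      show "supported (multiples n E) \<noteq> ({} :: 'k mpoly set)"
        using zero_supported by blast
    qed (use sub add_supported in auto)
  next
    fix p q :: "'k mpoly" assume "p \<in> supported (multiples n E)" "q \<in> carrier (poly_ring n)"
    then show "q \<otimes>\<^bsub>poly_ring n\<^esub> p \<in> supported (multiples n E)"
      "p \<otimes>\<^bsub>poly_ring n\<^esub> q \<in> supported (multiples n E)"
      using mult[of q p] by (simp_all add: mult.commute)
  qed
qed

text \<open>One inclusion is minimality of the generated ideal. For the other, a polynomial is taken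
  apart term by term, and each term is a ring multiple of a generator.\<close>

lemma genideal_monomials:
  assumes "E \<subseteq> mons n"
  shows "genideal (poly_ring n) ((\<lambda>g. Poly_Mapping.single g (1::'k::field)) ` E) = supported (multiples n E)"
    (is "genideal _ ?X = ?J")
proof
  interpret cring "poly_ring n :: 'k mpoly ring" by (rule cring_poly_ring)
  have X: "?X \<subseteq> carrier (poly_ring n)" using assms by (auto intro: single_supported)
  have "E \<subseteq> multiples n E" using assms by (force simp: multiples_def)
  then show "genideal (poly_ring n) ?X \<subseteq> ?J"
    by (intro genideal_minimal ideal_supported_multiples) (auto intro: single_supported)
  interpret I: ideal "genideal (poly_ring n) ?X" "poly_ring n" by (rule genideal_ideal[OF X])
  have mono: "Poly_Mapping.single m c \<in> genideal (poly_ring n) ?X" if "m \<in> multiples n E" for m c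
  proof -
    from that obtain g h where gh: "g \<in> E" "m = g + h" "h \<in> mons n"
      by (auto simp: multiples_def add_in_mons_iff)
    have "Poly_Mapping.single g 1 \<in> genideal (poly_ring n) ?X"
      using genideal_self[OF X] gh(1) by blast
    then have "Poly_Mapping.single g 1 * Poly_Mapping.single h c \<in> genideal (poly_ring n) ?X"
      using I.I_r_closed[of "Poly_Mapping.single g 1" "Poly_Mapping.single h c"] gh(3)
      by (simp add: single_supported)
    then show ?thesis by (simp add: mult_single gh(2))
  qed
  have "p \<in> genideal (poly_ring n) ?X"
    if "finite T" "T \<subseteq> multiples n E" "p \<in> supported T" for T p
    using that
  proof (induction T arbitrary: p)
    case empty
    then show ?case using I.zero_closed by (simp add: supported_def)
  next
    case (insert m T)
    let ?s = "Poly_Mapping.single m (Poly_Mapping.lookup p m)"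
    have "p - ?s \<in> supported T"
      by (rule remove_monomial_supported) (rule insert.prems)
    then have "p - ?s \<in> genideal (poly_ring n) ?X" using insert by auto
    then have "(p - ?s) + ?s \<in> genideal (poly_ring n) ?X"
      using I.a_closed[of "p - ?s" ?s] mono[of m] insert.prems by simp
    then show ?case by simp
  qed
  from this[of "Poly_Mapping.keys p" p for p] show "?J \<subseteq> genideal (poly_ring n) ?X"
    by (auto simp: supported_def)
qed

section \<open>Quotients as vector spaces over the constants\<close>

lemma subfield_constants:
  "subfield (range (const :: 'k::field \<Rightarrow> 'k mpoly)) (poly_ring n)"
proof -
  interpret cring "poly_ring n :: 'k mpoly ring" by (rule cring_poly_ring)
  let ?K = "range (const :: 'k \<Rightarrow> 'k mpoly)"
  have cc: "const c \<in> supported (mons n)" for c :: 'k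
    by (simp add: const_def single_supported)
  have mult: "const c * const e = const (c * e)" for c e :: 'k
    by (simp add: const_def mult_single)
  have one: "const 1 = (1 :: 'k mpoly)" by (simp add: const_def)
  have zero: "const c = 0 \<longleftrightarrow> c = 0" for c :: 'k
    unfolding const_def by (metis single_zero lookup_single_eq lookup_zero)
  have sub: "subring ?K (poly_ring n)"
  proof (rule subringI)
    fix p q assume "p \<in> ?K" "q \<in> ?K"
    then show "p \<oplus>\<^bsub>poly_ring n\<^esub> q \<in> ?K" by (auto simp: const_def single_add[symmetric])
  next
    fix p assume "p \<in> ?K"
    then show "\<ominus>\<^bsub>poly_ring n\<^esub> p \<in> ?K"
      using cc by (auto simp: a_inv_poly_ring const_def single_uminus[symmetric])
  qed (use cc one[symmetric] in \<open>auto simp: mult\<close>)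
  show ?thesis
  proof (rule subfieldI)
    show "subcring ?K (poly_ring n)"
      by (rule subcringI[OF sub]) (simp add: mult.commute)
    show "Units (poly_ring n\<lparr>carrier := ?K\<rparr>) = ?K - {\<zero>\<^bsub>poly_ring n\<^esub>}"
    proof (intro equalityI subsetI)
      fix p assume "p \<in> Units (poly_ring n\<lparr>carrier := ?K\<rparr>)"
      then obtain q where "p \<in> ?K" "q * p = 1" by (auto simp: Units_def)
      then show "p \<in> ?K - {\<zero>\<^bsub>poly_ring n\<^esub>}" by auto
    next
      fix p assume "p \<in> ?K - {\<zero>\<^bsub>poly_ring n\<^esub>}"
      then obtain c where c: "p = const c" "c \<noteq> 0" using zero by auto
      then have "const (inverse c) * p = 1" "p * const (inverse c) = 1"
        by (simp_all add: mult one)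
      then show "p \<in> Units (poly_ring n\<lparr>carrier := ?K\<rparr>)"
        using c by (auto simp: Units_def intro!: bexI[of _ "const (inverse c)"])
    qed
  qed
qed

lemma a_r_coset_poly_ring_eq_iff:
  assumes "ideal J (poly_ring n)" "p \<in> supported (mons n)" "q \<in> supported (mons n)"
  shows "J +>\<^bsub>poly_ring n\<^esub> p = J +>\<^bsub>poly_ring n\<^esub> q \<longleftrightarrow> p - q \<in> J"
proof -
  interpret ideal J "poly_ring n" by fact
  have "J +>\<^bsub>poly_ring n\<^esub> p = J +>\<^bsub>poly_ring n\<^esub> q \<longleftrightarrow> p \<in> J +>\<^bsub>poly_ring n\<^esub> q"
  proof
    assume "J +>\<^bsub>poly_ring n\<^esub> p = J +>\<^bsub>poly_ring n\<^esub> q"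
    then show "p \<in> J +>\<^bsub>poly_ring n\<^esub> q" using a_rcos_self[of p] assms(2) by simp
  next
    assume "p \<in> J +>\<^bsub>poly_ring n\<^esub> q"
    then show "J +>\<^bsub>poly_ring n\<^esub> p = J +>\<^bsub>poly_ring n\<^esub> q"
      using a_repr_independence[of p J q] a_subgroup assms(3) unfolding poly_ring_simps by metis
  qed
  also have "\<dots> \<longleftrightarrow> p \<oplus>\<^bsub>poly_ring n\<^esub> \<ominus>\<^bsub>poly_ring n\<^esub> q \<in> J"
    using assms by (intro a_rcos_module) auto
  also have "p \<oplus>\<^bsub>poly_ring n\<^esub> \<ominus>\<^bsub>poly_ring n\<^esub> q = p - q"
    using assms(3) by (simp add: a_inv_poly_ring)
  finally show ?thesis .
qed

text \<open>The standard monomials form a basis of the quotient: each one added extends the span by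
  a line, and all of them exhaust the quotient. The zero ring is included, with no standard
  monomials.\<close>

lemma has_quotient_dim_supported:
  fixes n :: nat and E :: "(nat \<Rightarrow>\<^sub>0 nat) set"
  defines "J \<equiv> supported (multiples n E) :: 'k::field mpoly set"
  assumes fin: "finite (mons n - multiples n E)"
  shows "has_quotient_dim (poly_ring n) J (card (mons n - multiples n E))"
proof -
  let ?R = "poly_ring n :: 'k mpoly ring"
  have J: "ideal J ?R" unfolding J_def by (rule ideal_supported_multiples)
  interpret J: ideal J ?R by fact
  interpret h: ring_hom_ring ?R "?R Quot J" "(+>\<^bsub>?R\<^esub>) J" by (rule J.rcos_ring_hom_ring)
  let ?h = "(+>\<^bsub>?R\<^esub>) J" and ?K = "range (\<lambda>c. J +>\<^bsub>?R\<^esub> const c)"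
  have cc: "const c \<in> supported (mons n)" for c :: 'k
    by (simp add: const_def single_supported)
  have dim: "ring.dimension (?R Quot J) (card T) ?K (?h ` supported T)"
    if "finite T" "T \<subseteq> mons n - multiples n E" for T
    using that
  proof (induction T)
    case empty
    have "?h ` supported {} = {\<zero>\<^bsub>?R Quot J\<^esub>}"
      using h.hom_zero by (simp add: supported_def)
    then show ?case using h.S.dimension.intros(1) by simp
  next
    case (insert m T)
    let ?v = "?h (Poly_Mapping.single m 1)"
    have m: "m \<in> mons n" "m \<notin> multiples n E" and T: "T \<subseteq> mons n" using insert.prems by auto
    note TS = subsetD[OF supported_mono[OF T]]
    have v: "(Poly_Mapping.single m 1 :: 'k mpoly) \<in> supported (mons n)"
      using m(1) by (rule single_supported)
    have notin: "?v \<notin> ?h ` supported T"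
    proof
      assume "?v \<in> ?h ` supported T"
      then obtain q where q: "q \<in> supported T" "?h (Poly_Mapping.single m 1) = ?h q" by auto
      then have "Poly_Mapping.single m 1 - q \<in> J"
        using a_r_coset_poly_ring_eq_iff[OF J v TS] by simp
      \<comment> \<open>The coefficient 1 at \<open>m\<close> survives because \<open>m\<close> is
        not in \<open>T\<close>, whereas members of \<open>J\<close> contain only multiples of
        generators.\<close>
      moreover have "m \<in> Poly_Mapping.keys (Poly_Mapping.single m 1 - q)"
      proof -
        have "m \<notin> Poly_Mapping.keys q" using q(1) insert.hyps(2) by (auto simp: supported_def)
        then show ?thesis by (simp add: in_keys_iff lookup_minus)
      qed
      ultimately show False using m(2) by (auto simp: J_def supported_def)
    qed
    have line: "?h (const c * Poly_Mapping.single m 1 + q)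
        = ?h (const c) \<otimes>\<^bsub>?R Quot J\<^esub> ?v \<oplus>\<^bsub>?R Quot J\<^esub> ?h q" if "q \<in> supported T" for c q
      using h.hom_add[of "const c * Poly_Mapping.single m 1" q]
        h.hom_mult[of "const c" "Poly_Mapping.single m 1"] cc v TS[OF that] mult_supported[OF cc v]
      by simp
    have cm: "const c * Poly_Mapping.single m 1 = Poly_Mapping.single m c" for c :: 'k
      by (simp add: const_def mult_single)
    have "h.S.line_extension ?K ?v (?h ` supported T) = ?h ` supported (insert m T)"
    proof (intro equalityI subsetI)
      fix x assume "x \<in> h.S.line_extension ?K ?v (?h ` supported T)"
      then obtain c q where "q \<in> supported T" "x = ?h (const c * Poly_Mapping.single m 1 + q)"
        unfolding h.S.line_extension_mem_iff using line by auto
      moreover from this(1) have "q \<in> supported (insert m T)" by (auto simp: supported_def)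
      ultimately show "x \<in> ?h ` supported (insert m T)"
        by (auto simp: cm intro!: imageI add_supported single_supported)
    next
      fix x assume "x \<in> ?h ` supported (insert m T)"
      then obtain p where p: "p \<in> supported (insert m T)" "x = ?h p" by auto
      let ?q = "p - Poly_Mapping.single m (Poly_Mapping.lookup p m)"
      have q: "?q \<in> supported T"
        using p(1) by (rule remove_monomial_supported)
      have "x = ?h (const (Poly_Mapping.lookup p m) * Poly_Mapping.single m 1 + ?q)"
        by (simp add: cm p(2))
      then show "x \<in> h.S.line_extension ?K ?v (?h ` supported T)"
        unfolding h.S.line_extension_mem_iff using line[OF q] q by blast
    qed
    moreover have "ring.dimension (?R Quot J) (Suc (card T)) ?K (h.S.line_extension ?K ?v (?h ` supported T))"
      using insert.IH insert.prems notin v by (intro h.S.dimension.intros(2)) auto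
    ultimately show ?case using insert.hyps by simp
  qed
  have "carrier (?R Quot J) = ?h ` supported (mons n - multiples n E)"
  proof (intro equalityI subsetI)
    fix x assume "x \<in> carrier (?R Quot J)"
    then obtain p where p: "p \<in> supported (mons n)" "x = ?h p"
      by (auto simp: FactRing_def A_RCOSETS_def')
    \<comment> \<open>The representative is obtained by dropping all terms that lie in the
      ideal.\<close>
    let ?q = "Poly_Mapping.mapp (\<lambda>k c. c when k \<notin> multiples n E) p"
    have q: "?q \<in> supported (mons n - multiples n E)"
      using p(1) by (auto simp: supported_def in_keys_iff lookup_mapp when_def split: if_splits)
    then have "?q \<in> supported (mons n)" by (auto simp: supported_def)
    moreover have "p - ?q \<in> J"
      unfolding J_def
      by (auto simp: supported_def in_keys_iff lookup_minus lookup_mapp when_def split: if_splits)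
    ultimately have "?h p = ?h ?q" using a_r_coset_poly_ring_eq_iff[OF J p(1)] by simp
    then show "x \<in> ?h ` supported (mons n - multiples n E)" using p(2) q by blast
  next
    fix x assume "x \<in> ?h ` supported (mons n - multiples n E)"
    moreover have "supported (mons n - multiples n E) \<subseteq> carrier ?R"
      by (auto simp: supported_def)
    ultimately show "x \<in> carrier (?R Quot J)" using h.hom_closed by blast
  qed
  then show ?thesis
    unfolding has_quotient_dim_def using dim[OF fin order_refl] by simp
qed

text \<open>Over a subfield the dimension is unique, and properness of \<open>J\<close> gives 1
  distinct from 0 in the quotient, which makes the image of the constants a subfield.\<close>

lemma has_quotient_dim_unique:
  fixes J :: "'k::field mpoly set"
  assumes "ideal J (poly_ring n)" "J \<noteq> carrier (poly_ring n)"
    and "has_quotient_dim (poly_ring n) J k" "has_quotient_dim (poly_ring n) J l"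
  shows "k = l"
proof -
  let ?R = "poly_ring n :: 'k mpoly ring"
  interpret J: ideal J ?R by fact
  interpret h: ring_hom_ring ?R "?R Quot J" "(+>\<^bsub>?R\<^esub>) J" by (rule J.rcos_ring_hom_ring)
  have "\<one>\<^bsub>?R\<^esub> \<notin> J" using assms(2) J.one_imp_carrier by blast
  then have "\<one>\<^bsub>?R Quot J\<^esub> \<noteq> \<zero>\<^bsub>?R Quot J\<^esub>"
    using J.a_rcos_self[of "\<one>\<^bsub>?R\<^esub>"] one_supported by (auto simp: FactRing_def)
  then have "subfield ((+>\<^bsub>?R\<^esub>) J ` range const) (?R Quot J)"
    by (rule h.img_is_subfield(2)[OF subfield_constants])
  then have "subfield (range (\<lambda>c. J +>\<^bsub>?R\<^esub> const c)) (?R Quot J)"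
    by (simp add: image_image)
  then show ?thesis
    using h.S.dimension_is_inj assms(3,4) unfolding has_quotient_dim_def by blast
qed

lemma multiples_single_add_iff:
  fixes k l :: nat
  assumes "i \<noteq> j"
  shows "(\<exists>h. m = Poly_Mapping.single i k + Poly_Mapping.single j l + h)
    \<longleftrightarrow> k \<le> Poly_Mapping.lookup m i \<and> l \<le> Poly_Mapping.lookup m j"
    (is "?L \<longleftrightarrow> ?R")
proof
  assume ?R
  \<comment> \<open>Subtraction of exponents is truncated; the two bounds make it exact.\<close>
  then have "m = Poly_Mapping.single i k + Poly_Mapping.single j l
      + (m - (Poly_Mapping.single i k + Poly_Mapping.single j l))"
    using assms by (intro poly_mapping_eqI) (auto simp: lookup_add lookup_minus lookup_single when_def)
  then show ?L by blast
qed (use assms in \<open>auto simp: lookup_add lookup_single\<close>)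

lemma multiples_single_iff:
  fixes k :: nat
  shows "(\<exists>h. m = Poly_Mapping.single i k + h) \<longleftrightarrow> k \<le> Poly_Mapping.lookup m i"
  (is "?L \<longleftrightarrow> ?R")
proof
  assume ?R
  then have "m = Poly_Mapping.single i k + (m - Poly_Mapping.single i k)"
    by (intro poly_mapping_eqI) (auto simp: lookup_add lookup_minus lookup_single when_def)
  then show ?L by blast
qed (auto simp: lookup_add)

lemma var_power: "var i ^ k = (Poly_Mapping.single (Poly_Mapping.single i k) 1 :: 'k::field mpoly)"
proof (induction k)
  case (Suc k)
  have "Poly_Mapping.single i (1::nat) + Poly_Mapping.single i k = Poly_Mapping.single i (Suc k)"
    by (simp add: single_add[symmetric])
  with Suc show ?case by (simp add: var_def mult_single)
qed simp

section \<open>Standard monomials of the 1-skeleton ideal\<close>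

locale rooted_multigraph =
  fixes G :: multigraph and n a :: nat
  assumes a_pos: "1 \<le> a"
    and wf: "wf_multigraph G"
    and verts_G: "verts G = {0..n}"
    and sub: "subgraph G (complete_multigraph {0..n} a 1)"
begin

lemma emult_sym: "emult G u v = emult G v u"
  and emult_irrefl [simp]: "emult G u u = 0"
  using wf unfolding wf_multigraph_def by auto

lemma emult_le_complete: "emult G u v \<le> emult (complete_multigraph {0..n} a 1) u v"
  using sub by (simp add: subgraph_def)

lemma emult_le_one: "u \<noteq> 0 \<Longrightarrow> v \<noteq> 0 \<Longrightarrow> emult G u v \<le> 1"
  using emult_le_complete[of u v] by (auto simp: complete_multigraph_def split: if_splits)

lemma emult_le: "emult G u v \<le> a"
  using emult_le_complete[of u v] a_pos by (auto simp: complete_multigraph_def split: if_splits)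

text \<open>Indices are shifted as in the matrix: \<open>i\<close> stands for the vertex
  \<open>Suc i\<close>, which leaves out the root.\<close>

definition adjacent :: "nat \<Rightarrow> nat \<Rightarrow> bool" where
  "adjacent u v \<longleftrightarrow> emult G (Suc u) (Suc v) \<noteq> 0"

sublocale weighted_graph adjacent "\<lambda>i. real (vdegree G (Suc i))"
  by unfold_locales (simp_all add: adjacent_def emult_sym)

text \<open>The degree also counts the edges to the root.\<close>

lemma card_nbrs_le: "card (nbrs {0..<n} v) \<le> vdegree G (Suc v)"
proof -
  let ?N = "nbrs {0..<n} v"
  have "card ?N = (\<Sum>u\<in>?N. 1)" by simp
  also have "\<dots> \<le> (\<Sum>u\<in>?N. emult G (Suc v) (Suc u))"
    by (rule sum_mono) (auto simp: nbrs_def adjacent_def)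
  also have "\<dots> = (\<Sum>j\<in>Suc ` ?N. emult G (Suc v) j)"
    by (simp add: sum.reindex)
  also have "\<dots> \<le> vdegree G (Suc v)"
    unfolding vdegree_def verts_G by (rule sum_mono2) (auto simp: nbrs_def adjacent_def)
  finally show ?thesis .
qed

lemma det_trunc_signless_laplace:
  "real_of_int (det (trunc_signless_laplace n G)) = pdet laplace {0..<n}"
proof -
  let ?A = "trunc_signless_laplace n G"
  have A: "?A \<in> carrier_mat n n" by (simp add: trunc_signless_laplace_def)
  \<comment> \<open>Away from the root multiplicities are 0 or 1, so they agree with the indicator
    in \<open>laplace\<close>.\<close>
  have entry: "real_of_int (?A $$ (i, j)) = laplace i j" if "i < n" "j < n" for i j
    using that emult_le_one[of "Suc i" "Suc j"] by (auto simp: trunc_signless_laplace_def laplace_def adjacent_def)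
  show ?thesis
    unfolding det_def'[OF A] pdet_def of_int_sum of_int_mult of_int_prod
  proof (intro sum.cong refl arg_cong2[where f="(*)"] prod.cong)
    fix p i assume "p \<in> {p. p permutes {0..<n}}" "i \<in> {0..<n}"
    then have "i < n" "p i < n" using permutes_in_image[of p "{0..<n}" i] by auto
    then show "real_of_int (?A $$ (i, p i)) = laplace i (p i)" by (rule entry)
  qed simp
qed

definition generator_exponents :: "(nat \<Rightarrow>\<^sub>0 nat) set" where
  "generator_exponents =
     {Poly_Mapping.single i (vdegree G i) | i. i \<in> {1..n}} \<union>
     {Poly_Mapping.single i (vdegree G i - emult G i j) + Poly_Mapping.single j (vdegree G j - emult G i j)
       | i j. 1 \<le> i \<and> i < j \<and> j \<le> n}"

lemma generator_exponents_subset: "generator_exponents \<subseteq> mons n"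
  by (auto simp: generator_exponents_def add_in_mons_iff) (auto simp: mons_def split: if_splits)

lemma one_skeleton_ideal_eq:
  "one_skeleton_ideal n G = (supported (multiples n generator_exponents) :: 'k::field mpoly set)"
proof -
  have "{var i ^ vdegree G i | i. i \<in> {1..n}} \<union>
      {var i ^ (vdegree G i - emult G i j) * var j ^ (vdegree G j - emult G i j) | i j.
         1 \<le> i \<and> i < j \<and> j \<le> n}
      = (\<lambda>g. Poly_Mapping.single g (1::'k)) ` generator_exponents"
    unfolding generator_exponents_def var_power mult_single image_Un mult_1
    by (rule arg_cong2[where f="(\<union>)"]) (auto simp: image_Collect)
  then show ?thesis
    unfolding one_skeleton_ideal_def by (simp add: genideal_monomials[OF generator_exponents_subset])
qed

lemma carrier_if_zero_exponent:
  assumes "0 \<in> generator_exponents"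
  shows "one_skeleton_ideal n G = (carrier (poly_ring n) :: 'k::field mpoly set)"
proof -
  have "multiples n generator_exponents = mons n"
    using assms by (force simp: multiples_def)
  then show ?thesis by (simp add: one_skeleton_ideal_eq)
qed

text \<open>A vertex of degree 0 would contribute the generator 1.\<close>

lemma proper_imp_degree_pos:
  assumes "one_skeleton_ideal n G \<noteq> (carrier (poly_ring n) :: 'k::field mpoly set)" "i \<in> {0..<n}"
  shows "1 \<le> vdegree G (Suc i)"
proof (rule ccontr)
  assume "\<not> 1 \<le> vdegree G (Suc i)"
  then have "vdegree G (Suc i) = 0" by simp
  then have "Poly_Mapping.single (Suc i) (vdegree G (Suc i)) = 0" by simp
  then have "0 \<in> generator_exponents"
    using assms(2) unfolding generator_exponents_def by force
  with assms(1) carrier_if_zero_exponent show False by blast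
qed

text \<open>For adjacent vertices of degree 1 both exponents of the pair generator are 0, so it
  would be 1.\<close>

lemma proper_imp_indep:
  assumes "one_skeleton_ideal n G \<noteq> (carrier (poly_ring n) :: 'k::field mpoly set)"
  shows "indep {i \<in> {0..<n}. real (vdegree G (Suc i)) = 1}"
proof (rule ccontr)
  assume "\<not> ?thesis"
  then obtain u v where uv: "u < n" "v < n" "vdegree G (Suc u) = 1" "vdegree G (Suc v) = 1"
    "emult G (Suc u) (Suc v) \<noteq> 0"
    unfolding indep_def adjacent_def by auto
  have "\<exists>i j. 1 \<le> i \<and> i < j \<and> j \<le> n \<and> vdegree G i = 1 \<and> vdegree G j = 1 \<and> emult G i j = 1"
  proof (cases "u < v")
    case True
    then show ?thesis
      using uv emult_le_one[of "Suc u" "Suc v"] by (intro exI[of _ "Suc u"] exI[of _ "Suc v"]) simp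
  next
    case False
    moreover have "u \<noteq> v" using uv(5) by auto
    ultimately show ?thesis
      using uv emult_le_one[of "Suc v" "Suc u"] emult_sym[of "Suc u" "Suc v"]
      by (intro exI[of _ "Suc v"] exI[of _ "Suc u"]) simp
  qed
  then obtain i j where ij: "1 \<le> i" "i < j" "j \<le> n" "vdegree G i = 1" "vdegree G j = 1" "emult G i j = 1"
    by blast
  then have "Poly_Mapping.single i (vdegree G i - emult G i j)
      + Poly_Mapping.single j (vdegree G j - emult G i j) = 0" by simp
  then have "0 \<in> generator_exponents"
    using ij(1-3) unfolding generator_exponents_def by force
  with assms carrier_if_zero_exponent show False by blast
qed

lemma in_multiples_generator_exponents_iff:
  "m \<in> multiples n generator_exponents \<longleftrightarrow> m \<in> mons n \<and>
    ((\<exists>i\<in>{1..n}. vdegree G i \<le> Poly_Mapping.lookup m i) \<or>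
     (\<exists>i j. 1 \<le> i \<and> i < j \<and> j \<le> n \<and> vdegree G i - emult G i j \<le> Poly_Mapping.lookup m i
        \<and> vdegree G j - emult G i j \<le> Poly_Mapping.lookup m j))"
proof -
  have "(\<exists>g\<in>generator_exponents. \<exists>h. m = g + h) \<longleftrightarrow>
      (\<exists>i\<in>{1..n}. \<exists>h. m = Poly_Mapping.single i (vdegree G i) + h) \<or>
      (\<exists>i j. 1 \<le> i \<and> i < j \<and> j \<le> n \<and> (\<exists>h. m = Poly_Mapping.single i (vdegree G i - emult G i j)
          + Poly_Mapping.single j (vdegree G j - emult G i j) + h))"
    unfolding generator_exponents_def by blast
  also have "\<dots> \<longleftrightarrow> (\<exists>i\<in>{1..n}. vdegree G i \<le> Poly_Mapping.lookup m i) \<or>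
     (\<exists>i j. 1 \<le> i \<and> i < j \<and> j \<le> n \<and> vdegree G i - emult G i j \<le> Poly_Mapping.lookup m i
        \<and> vdegree G j - emult G i j \<le> Poly_Mapping.lookup m j)"
    unfolding multiples_single_iff
    by (intro disj_cong refl ex_cong1 conj_cong) (simp add: multiples_single_add_iff)
  finally show ?thesis by (simp add: multiples_def)
qed

definition std_monomials :: "(nat \<Rightarrow>\<^sub>0 nat) set" where
  "std_monomials = mons n - multiples n generator_exponents"

definition bounded_funs :: "(nat \<Rightarrow> nat) set" where
  "bounded_funs = {b \<in> PiE {0..<n} (\<lambda>i. {..<vdegree G (Suc i)}).
     indep {i \<in> {0..<n}. b i = vdegree G (Suc i) - 1}}"

lemma std_monomials_iff:
  assumes "m \<in> mons n"
  shows "m \<in> std_monomials \<longleftrightarrow> restrict (\<lambda>i. Poly_Mapping.lookup m (Suc i)) {0..<n} \<in> bounded_funs"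
    (is "_ \<longleftrightarrow> ?b \<in> _")
proof -
  let ?l = "Poly_Mapping.lookup m"
  have "m \<in> std_monomials \<longleftrightarrow> (\<forall>i\<in>{1..n}. ?l i < vdegree G i) \<and>
      (\<forall>i j. 1 \<le> i \<longrightarrow> i < j \<longrightarrow> j \<le> n \<longrightarrow>
        \<not> (vdegree G i - emult G i j \<le> ?l i \<and> vdegree G j - emult G i j \<le> ?l j))"
    using assms
    by (simp only: std_monomials_def Diff_iff in_multiples_generator_exponents_iff simp_thms de_Morgan_disj
        de_Morgan_conj bex_simps not_ex imp_conv_disj not_le)
  \<comment> \<open>Once all exponents are below the degrees, a pair generator divides
    \<open>m\<close> only if the two vertices are adjacent and both exponents are one less than the
    degree. The condition also becomes symmetric in \<open>i\<close> and \<open>j\<close>.\<close>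
  also have "\<dots> \<longleftrightarrow> (\<forall>i\<in>{1..n}. ?l i < vdegree G i) \<and>
      (\<forall>i\<in>{1..n}. \<forall>j\<in>{1..n}. ?l i = vdegree G i - 1 \<longrightarrow> ?l j = vdegree G j - 1 \<longrightarrow> emult G i j = 0)"
    (is "?A \<and> ?B \<longleftrightarrow> ?A \<and> ?C")
  proof (rule conj_cong[OF refl], rule iffI)
    assume A: ?A
    {
      assume B: ?B
      have less: "emult G i j = 0" if "i < j" "1 \<le> i" "j \<le> n" "?l i = vdegree G i - 1"
        "?l j = vdegree G j - 1" for i j
      proof (rule ccontr)
        assume "emult G i j \<noteq> 0"
        then have "emult G i j = 1" using emult_le_one[of i j] that by simp
        moreover have "\<not> (vdegree G i - emult G i j \<le> ?l i \<and> vdegree G j - emult G i j \<le> ?l j)"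
          using B that(1-3) by blast
        ultimately show False using that(4,5) by simp
      qed
      show ?C
      proof (intro ballI impI)
        fix i j assume "i \<in> {1..n}" "j \<in> {1..n}" "?l i = vdegree G i - 1" "?l j = vdegree G j - 1"
        then show "emult G i j = 0"
          using less[of i j] less[of j i] emult_sym[of i j] by (cases i j rule: linorder_cases) auto
      qed
    }
    {
      assume C: ?C
      show ?B
      proof (intro allI impI notI)
        fix i j assume ij: "1 \<le> i" "i < j" "j \<le> n"
          and le: "vdegree G i - emult G i j \<le> ?l i \<and> vdegree G j - emult G i j \<le> ?l j"
        have lt: "?l i < vdegree G i" "?l j < vdegree G j" using A ij by auto
        with le have "emult G i j = 1" using emult_le_one[of i j] ij by (cases "emult G i j") auto
        with le lt have "?l i = vdegree G i - 1" "?l j = vdegree G j - 1" by auto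
        with C ij have "emult G i j = 0" by auto
        with \<open>emult G i j = 1\<close> show False by simp
      qed
    }
  qed
  also have "\<dots> \<longleftrightarrow> (\<forall>i\<in>Suc ` {0..<n}. ?l i < vdegree G i) \<and>
      (\<forall>i\<in>Suc ` {0..<n}. \<forall>j\<in>Suc ` {0..<n}.
        ?l i = vdegree G i - 1 \<longrightarrow> ?l j = vdegree G j - 1 \<longrightarrow> emult G i j = 0)"
    by (simp only: image_Suc_atLeastLessThan atLeastLessThanSuc_atLeastAtMost One_nat_def)
  also have "\<dots> \<longleftrightarrow> (\<forall>i\<in>{0..<n}. ?l (Suc i) < vdegree G (Suc i)) \<and>
      (\<forall>i\<in>{0..<n}. \<forall>j\<in>{0..<n}. ?l (Suc i) = vdegree G (Suc i) - 1 \<longrightarrow>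
        ?l (Suc j) = vdegree G (Suc j) - 1 \<longrightarrow> emult G (Suc i) (Suc j) = 0)"
    by (simp only: ball_simps)
  also have "\<dots> \<longleftrightarrow> ?b \<in> bounded_funs"
    unfolding bounded_funs_def indep_def adjacent_def by (auto simp: PiE_iff)
  finally show ?thesis .
qed

lemma bij_betw_std_monomials: "bij_betw (\<lambda>m. restrict (\<lambda>i. Poly_Mapping.lookup m (Suc i)) {0..<n}) std_monomials bounded_funs"
proof (rule bij_betw_imageI)
  show "inj_on (\<lambda>m. restrict (\<lambda>i. Poly_Mapping.lookup m (Suc i)) {0..<n}) std_monomials"
  proof (rule inj_onI, rule poly_mapping_eqI)
    fix x y k
    assume xy: "x \<in> std_monomials" "y \<in> std_monomials"
      and eq: "restrict (\<lambda>i. Poly_Mapping.lookup x (Suc i)) {0..<n}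
             = restrict (\<lambda>i. Poly_Mapping.lookup y (Suc i)) {0..<n}"
    show "Poly_Mapping.lookup x k = Poly_Mapping.lookup y k"
    proof (cases "k \<in> {1..n}")
      case True
      then obtain i where "k = Suc i" "i < n" by (cases k) auto
      then show ?thesis using fun_cong[OF eq, of i] by simp
    next
      case False
      then have "k \<notin> Poly_Mapping.keys x" "k \<notin> Poly_Mapping.keys y"
        using xy by (auto simp: std_monomials_def mons_def)
      then show ?thesis by (simp add: in_keys_iff)
    qed
  qed
  show "(\<lambda>m. restrict (\<lambda>i. Poly_Mapping.lookup m (Suc i)) {0..<n}) ` std_monomials = bounded_funs"
  proof (intro equalityI subsetI)
    fix b assume "b \<in> (\<lambda>m. restrict (\<lambda>i. Poly_Mapping.lookup m (Suc i)) {0..<n}) ` std_monomials"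
    then obtain m where "m \<in> std_monomials" "b = restrict (\<lambda>i. Poly_Mapping.lookup m (Suc i)) {0..<n}" by blast
    then show "b \<in> bounded_funs" using std_monomials_iff[of m] by (simp add: std_monomials_def)
  next
    fix b assume b: "b \<in> bounded_funs"
    \<comment> \<open>The case distinction gives the variable with index 0 exponent 0; the truncated
      \<open>k - 1\<close> would give it \<open>b 0\<close>.\<close>
    define m where "m = Abs_poly_mapping (\<lambda>k. if k \<in> {1..n} then b (k - 1) else 0)"
    have lookup: "Poly_Mapping.lookup m k = (if k \<in> {1..n} then b (k - 1) else 0)" for k
      unfolding m_def by (subst lookup_Abs_poly_mapping) (auto intro: finite_subset[of _ "{1..n}"])
    have mons: "m \<in> mons n" by (auto simp: mons_def in_keys_iff lookup split: if_splits)
    have "b i = undefined" if "i \<notin> {0..<n}" for i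
      using b that by (auto simp: bounded_funs_def PiE_iff extensional_def)
    then have eq: "restrict (\<lambda>i. Poly_Mapping.lookup m (Suc i)) {0..<n} = b"
      by (auto simp: fun_eq_iff lookup restrict_def)
    then have "m \<in> std_monomials" using std_monomials_iff[OF mons] b by simp
    with eq show "b \<in> (\<lambda>m. restrict (\<lambda>i. Poly_Mapping.lookup m (Suc i)) {0..<n}) ` std_monomials" by blast
  qed
qed

lemma card_std_monomials: "finite std_monomials" "real (card std_monomials) = ipoly {0..<n}"
proof -
  have "finite bounded_funs"
    unfolding bounded_funs_def by (intro finite_subset[OF Collect_restrict] finite_PiE) auto
  then show "finite std_monomials" using bij_betw_finite[OF bij_betw_std_monomials] by simp
  have "real (card bounded_funs) = ipoly {0..<n}"
    unfolding bounded_funs_def by (rule card_bounded_functions) (use card_nbrs_le in auto)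
  then show "real (card std_monomials) = ipoly {0..<n}" using bij_betw_same_card[OF bij_betw_std_monomials] by simp
qed

lemma has_quotient_dim_card_std_monomials:
  "has_quotient_dim (poly_ring n :: 'k::field mpoly ring) (one_skeleton_ideal n G) (card std_monomials)"
  using has_quotient_dim_supported[of n generator_exponents] card_std_monomials(1)
  unfolding one_skeleton_ideal_eq std_monomials_def by blast

section \<open>Essentially connected components and cliques\<close>

abbreviation complete_components :: bool where
  "complete_components \<equiv> (\<forall>H \<in> ess_connected_components G.
     \<exists>b\<ge>1. root_edge_deletion H (complete_multigraph (verts H) b 1))"

lemma clique_union_iff:
  "clique_union {0..<n} \<longleftrightarrow> (\<forall>u\<in>{1..n}. \<forall>v\<in>{1..n}. \<forall>w\<in>{1..n}.
     emult G v u \<noteq> 0 \<longrightarrow> emult G v w \<noteq> 0 \<longrightarrow> u \<noteq> w \<longrightarrow> emult G u w \<noteq> 0)"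
proof -
  have Suc_image: "{1..n} = Suc ` {0..<n}"
    by (simp only: image_Suc_atLeastLessThan atLeastLessThanSuc_atLeastAtMost One_nat_def)
  show ?thesis unfolding clique_union_def adjacent_def Suc_image ball_simps(9) nat.inject ..
qed

lemma adjacency_induced:
  "(u, v) \<in> adjacency (induced G (verts G - {0})) \<longleftrightarrow> u \<in> {1..n} \<and> v \<in> {1..n} \<and> emult G u v \<noteq> 0"
  by (auto simp: adjacency_def induced_def verts_G)

lemma ess_connected_components_iff:
  "H \<in> ess_connected_components G \<longleftrightarrow>
     (\<exists>v\<in>{1..n}. H = induced G (insert 0 ((adjacency (induced G (verts G - {0})))\<^sup>* `` {v})))"
proof -
  have "verts (induced G (verts G - {0})) = {1..n}"
    by (auto simp: induced_def verts_G)
  then show ?thesis unfolding ess_connected_components_def component_verts_def by blast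
qed

text \<open>Two neighbours of \<open>v\<close> lie in the component of \<open>v\<close>, where
  deleting root edges leaves the edge between them intact.\<close>

lemma clique_union_if_complete_components:
  assumes complete_components
  shows "clique_union {0..<n}"
  unfolding clique_union_iff
proof (intro ballI impI)
  fix u v w
  assume uvw: "u \<in> {1..n}" "v \<in> {1..n}" "w \<in> {1..n}" "emult G v u \<noteq> 0" "emult G v w \<noteq> 0" "u \<noteq> w"
  let ?V = "(adjacency (induced G (verts G - {0})))\<^sup>* `` {v}"
  let ?H = "induced G (insert 0 ?V)"
  have mem: "u \<in> ?V" "w \<in> ?V" using uvw by (auto simp: adjacency_induced intro!: r_into_rtrancl)
  have "?H \<in> ess_connected_components G" using uvw(2) ess_connected_components_iff by blast
  then obtain b where "root_edge_deletion ?H (complete_multigraph (verts ?H) b 1)"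
    using assms by blast
  then have "emult ?H u w = emult (complete_multigraph (verts ?H) b 1) u w"
    using uvw unfolding root_edge_deletion_def by auto
  then show "emult G u w \<noteq> 0"
    using mem uvw by (simp add: induced_def complete_multigraph_def)
qed

lemma complete_components_if_clique_union:
  assumes "clique_union {0..<n}"
  shows complete_components
proof
  fix H assume "H \<in> ess_connected_components G"
  then obtain v where v: "v \<in> {1..n}"
    and H: "H = induced G (insert 0 ((adjacency (induced G (verts G - {0})))\<^sup>* `` {v}))"
    (is "H = induced G (insert 0 ?V)")
    using ess_connected_components_iff by blast
  note clique = assms[unfolded clique_union_iff, rule_format]
  \<comment> \<open>Reachability collapses to a single step: the clique property shortcuts every
    path that starts at \<open>v\<close>.\<close>
  have V: "w \<in> {1..n} \<and> (w = v \<or> emult G v w \<noteq> 0)" if "w \<in> ?V" for w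
  proof -
    from that have "(v, w) \<in> (adjacency (induced G (verts G - {0})))\<^sup>*" by simp
    then show ?thesis
    proof (induction rule: rtrancl_induct)
      case (step w x)
      have wx: "w \<in> {1..n}" "x \<in> {1..n}" "emult G w x \<noteq> 0"
        using step.hyps(2) by (simp_all add: adjacency_induced)
      show ?case
      proof (cases "w = v \<or> x = v")
        case False
        then have "emult G w v \<noteq> 0" using step.IH emult_sym[of w v] by simp
        then have "emult G v x \<noteq> 0" using clique[of v w x] v wx False by simp
        then show ?thesis using wx by simp
      qed (use wx v in auto)
    qed (use v in simp)
  qed
  have one: "emult G u w = 1" if "u \<in> ?V" "w \<in> ?V" "u \<noteq> w" for u w
  proof -
    have uw: "u \<in> {1..n}" "w \<in> {1..n}" "u = v \<or> emult G v u \<noteq> 0" "w = v \<or> emult G v w \<noteq> 0"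
      using V that by auto
    have "emult G u w \<noteq> 0"
      using clique[of u v w] v uw that(3) emult_sym[of u v] by metis
    moreover have "emult G u w \<le> 1" using uw by (intro emult_le_one) auto
    ultimately show ?thesis by simp
  qed
  have "0 \<notin> ?V" using V by fastforce
  have vH: "verts H = insert 0 ?V" by (simp add: H induced_def)
  have le: "emult G u w \<le> 1" if "u \<in> ?V" "w \<in> ?V" for u w
    using one[OF that] by (cases "u = w") auto
  \<comment> \<open>The global bound \<open>a\<close> serves for every component, since any number
    of root edges may be deleted.\<close>
  have "root_edge_deletion H (complete_multigraph (verts H) a 1)"
    unfolding root_edge_deletion_def
  proof (intro conjI allI impI)
    show "verts H = verts (complete_multigraph (verts H) a 1)" by (simp add: complete_multigraph_def)
    show "emult H u w \<le> emult (complete_multigraph (verts H) a 1) u w" for u w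
      unfolding vH using le emult_le \<open>0 \<notin> ?V\<close> by (auto simp: H induced_def complete_multigraph_def)
    show "emult H u w = emult (complete_multigraph (verts H) a 1) u w" if "u \<noteq> 0 \<and> w \<noteq> 0" for u w
      unfolding vH using that one by (auto simp: H induced_def complete_multigraph_def)
  qed
  then show "\<exists>b\<ge>1. root_edge_deletion H (complete_multigraph (verts H) b 1)"
    using a_pos by blast
qed

lemma card_std_monomials_eq_det_iff:
  "int (card std_monomials) = det (trunc_signless_laplace n G) \<longleftrightarrow> pdet laplace {0..<n} = ipoly {0..<n}"
proof -
  have "int (card std_monomials) = det (trunc_signless_laplace n G)
      \<longleftrightarrow> real_of_int (int (card std_monomials)) = real_of_int (det (trunc_signless_laplace n G))"
    by (simp only: of_int_eq_iff)
  then show ?thesis using card_std_monomials(2) det_trunc_signless_laplace by auto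
qed

lemma quotient_dim_eq_det_if_complete_components:
  assumes complete_components
  shows "int (card std_monomials) = det (trunc_signless_laplace n G)"
  unfolding card_std_monomials_eq_det_iff
  using clique_union_if_complete_components[OF assms] by (rule pdet_eq_ipoly_if_clique_union[rotated]) simp

text \<open>Properness enters three times: it identifies \<open>m\<close> with the number of
  standard monomials, and it supplies both positivity conditions for strictness.\<close>

lemma complete_components_if_quotient_dim_eq_det:
  assumes "one_skeleton_ideal n G \<noteq> (carrier (poly_ring n) :: 'k::field mpoly set)"
    and "has_quotient_dim (poly_ring n) (one_skeleton_ideal n G :: 'k mpoly set) m"
    and "int m = det (trunc_signless_laplace n G)"
  shows complete_components
proof (rule complete_components_if_clique_union, rule clique_union_if_pdet_eq_ipoly)
  have "ideal (one_skeleton_ideal n G :: 'k mpoly set) (poly_ring n)"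
    unfolding one_skeleton_ideal_eq by (rule ideal_supported_multiples)
  then have "m = card std_monomials"
    using assms(1,2) has_quotient_dim_card_std_monomials by (rule has_quotient_dim_unique)
  then show "pdet laplace {0..<n} = ipoly {0..<n}" using assms(3) card_std_monomials_eq_det_iff by simp
  show "indep {i \<in> {0..<n}. real (vdegree G (Suc i)) = 1}" by (rule proper_imp_indep[OF assms(1)])
  show "1 \<le> real (vdegree G (Suc i))" if "i \<in> {0..<n}" for i
    using proper_imp_degree_pos[OF assms(1) that] by simp
  show "real (card (nbrs {0..<n} i)) \<le> real (vdegree G (Suc i))" for i
    using card_nbrs_le by simp
qed simp

end

theorem theorem3p10:
  fixes G :: multigraph and n a :: nat
    and R :: "'k::field mpoly ring" and M :: "'k mpoly set"
  assumes "1 \<le> a"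
    and "wf_multigraph G"
    and "verts G = {0..n}"
    and "subgraph G (complete_multigraph {0..n} a 1)"
    and "R = poly_ring n"
    and "M = one_skeleton_ideal n G"
  shows
    "(M \<noteq> carrier R \<longrightarrow>
        ((\<exists>m. has_quotient_dim R M m \<and> int m = det (trunc_signless_laplace n G)) \<longleftrightarrow>
         (\<forall>H \<in> ess_connected_components G.
            \<exists>b\<ge>1. root_edge_deletion H (complete_multigraph (verts H) b 1))))
     \<and> ((\<forall>H \<in> ess_connected_components G.
            \<exists>b\<ge>1. root_edge_deletion H (complete_multigraph (verts H) b 1)) \<longrightarrow>
        (\<exists>m. has_quotient_dim R M m \<and> int m = det (trunc_signless_laplace n G)))"
proof -
  interpret rooted_multigraph G n a
    using assms(1-4) by unfold_locales
  have if_complete: "\<exists>m. has_quotient_dim R M m \<and> int m = det (trunc_signless_laplace n G)"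
    if complete_components
    using quotient_dim_eq_det_if_complete_components[OF that] has_quotient_dim_card_std_monomials
    unfolding assms(5,6) by blast
  moreover have complete_components
    if "M \<noteq> carrier R" "has_quotient_dim R M m" "int m = det (trunc_signless_laplace n G)" for m
    using that unfolding assms(5,6) by (rule complete_components_if_quotient_dim_eq_det)
  ultimately show ?thesis by blast
qed

end
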